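(* Let $K$ be a field of characteristic $0$, let $M=(x,y,z)\subseteq K[x,y,z]$, and let $I\subseteq K[x,y,z]$ be the ideal of an almost collinear subscheme of $\mathbb{P}^2$ or of a nearly-complete intersection in $\mathbb{P}^2$. Then for all integers $m,t\geq 1$, $I^{(t(m+1))}\subseteq M^t(I^{(m)})^t$ and $I^{(t(m+1)-1)}\subseteq M^{t-1}(I^{(m)})^t$.
   Context: $K[\mathbb{P}^2]=K[x,y,z]$. The ideal of a finite set of distinct points $q_1,\dots,q_s\in\mathbb{P}^2$ is $I=\bigcap_i I(q_i)$, where $I(q_i)$ is the ideal generated by all forms vanishing at $q_i$; its $m$-th symbolic power is $I^{(m)}=\bigcap_i I(q_i)^m$. An almost collinear subscheme of $n+1$ points ($n\geq 2$) is a set of distinct points $p_0,p_1,\dots,p_n\in\mathbb{P}^2$ such that $p_1,\dots,p_n$ lie on a line $L$ and $p_0\notin L$. A nearly-complete intersection of $2n+1$ points ($n\geq 1$) is a set of distinct points $p_0,p_1,\dots,p_{2n}\in\mathbb{P}^2$ for which there are two distinct lines $L_1,L_2$ such that $p_0$ is the point $L_1\cap L_2$, $p_1,\dots,p_n\in L_1\setminus L_2$ and $p_{n+1},\dots,p_{2n}\in L_2\setminus L_1$. *)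

theory Defs
  imports
    "HOL-Analysis.Finite_Cartesian_Product"
    "HOL-Library.Poly_Mapping"
    "HOL-Library.Numeral_Type"
begin

text \<open>
  A polynomial is a finitely supported map from exponent vectors to coefficients; the three
  variables are indexed by the three-element type \<^typ>\<open>3\<close>. The ring structure is the
  convolution product of \<open>HOL-Library.Poly_Mapping\<close>.
\<close>

type_synonym 'k poly3 = "(3 \<Rightarrow>\<^sub>0 nat) \<Rightarrow>\<^sub>0 'k"

definition var :: "3 \<Rightarrow> 'k::comm_ring_1 poly3" where
  "var i = Poly_Mapping.single (Poly_Mapping.single i 1) 1"

definition eval_at :: "'k::comm_ring_1 poly3 \<Rightarrow> 'k ^ 3 \<Rightarrow> 'k" where
  "eval_at f v = (\<Sum>e\<in>Poly_Mapping.keys f. Poly_Mapping.lookup f e *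
      (\<Prod>i\<in>UNIV. (v $ i) ^ Poly_Mapping.lookup e i))"

text \<open>The zero polynomial is homogeneous of every degree.\<close>

definition homogeneous :: "nat \<Rightarrow> 'k::zero poly3 \<Rightarrow> bool" where
  "homogeneous d f \<longleftrightarrow> (\<forall>e\<in>Poly_Mapping.keys f. (\<Sum>i\<in>UNIV. Poly_Mapping.lookup e i) = d)"

text \<open>
  Regarding a commutative ring as a module over itself, \<open>rmod.subspace\<close> is the predicate
  ``is an ideal'' and \<open>rmod.span S\<close> is the ideal generated by \<open>S\<close>.
\<close>

interpretation rmod: module "(*) :: 'r::comm_ring_1 \<Rightarrow> 'r \<Rightarrow> 'r"
  by standard (simp_all add: algebra_simps)

definition ideal_mult :: "'r::comm_ring_1 set \<Rightarrow> 'r set \<Rightarrow> 'r set" where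
  "ideal_mult I J = rmod.span {a * b | a b. a \<in> I \<and> b \<in> J}"

primrec ideal_power :: "'r::comm_ring_1 set \<Rightarrow> nat \<Rightarrow> 'r set" where
  "ideal_power I 0 = UNIV"
| "ideal_power I (Suc n) = ideal_mult I (ideal_power I n)"

definition max_ideal :: "'k::comm_ring_1 poly3 set" where
  "max_ideal = rmod.span {var 0, var 1, var 2}"

definition proportional :: "'k::field ^ 3 \<Rightarrow> 'k ^ 3 \<Rightarrow> bool" where
  "proportional v w \<longleftrightarrow> v \<noteq> 0 \<and> w \<noteq> 0 \<and> (\<exists>c. c \<noteq> 0 \<and> w = c *s v)"

lemma part_equivp_proportional: "part_equivp (proportional :: 'k::field ^ 3 \<Rightarrow> _)"
proof (rule part_equivpI)
  have "proportional 1 (1 :: 'k ^ 3)"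
    unfolding proportional_def by (auto intro!: exI[of _ 1] simp: vec_eq_iff)
  then show "\<exists>v :: 'k ^ 3. proportional v v" ..
  show "symp (proportional :: 'k ^ 3 \<Rightarrow> _)"
  proof (rule sympI)
    fix v w :: "'k ^ 3"
    assume "proportional v w"
    then obtain c where c: "v \<noteq> 0" "w \<noteq> 0" "c \<noteq> 0" "w = c *s v"
      unfolding proportional_def by blast
    then have "v = inverse c *s w" by (simp add: vector_smult_assoc)
    with c show "proportional w v"
      unfolding proportional_def by (metis nonzero_imp_inverse_nonzero)
  qed
  show "transp (proportional :: 'k ^ 3 \<Rightarrow> _)"
  proof (rule transpI)
    fix u v w :: "'k ^ 3"
    assume "proportional u v" "proportional v w"
    then obtain c d where "u \<noteq> 0" "w \<noteq> 0" "c \<noteq> 0" "d \<noteq> 0" "v = c *s u" "w = d *s v"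
      unfolding proportional_def by blast
    then show "proportional u w"
      unfolding proportional_def by (metis no_zero_divisors vector_smult_assoc)
  qed
qed

quotient_type (overloaded) 'k proj_plane = "'k::field ^ 3" / partial: proportional
  morphisms rep_point point
  by (rule part_equivp_proportional)

definition coords :: "'k::field proj_plane \<Rightarrow> ('k ^ 3) set" where
  "coords p = {v. v \<noteq> 0 \<and> point v = p}"

definition vanishes_at :: "'k::field poly3 \<Rightarrow> 'k proj_plane \<Rightarrow> bool" where
  "vanishes_at f p \<longleftrightarrow> (\<forall>v\<in>coords p. eval_at f v = 0)"

definition is_line :: "'k::field proj_plane set \<Rightarrow> bool" where
  "is_line L \<longleftrightarrow> (\<exists>l. homogeneous 1 l \<and> l \<noteq> 0 \<and> L = {p. vanishes_at l p})"

definition point_ideal :: "'k::field proj_plane \<Rightarrow> 'k poly3 set" where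
  "point_ideal q = rmod.span {f. (\<exists>d. homogeneous d f) \<and> vanishes_at f q}"

definition ideal_of_points :: "'k::field proj_plane set \<Rightarrow> 'k poly3 set" where
  "ideal_of_points Z = (\<Inter>q\<in>Z. point_ideal q)"

text \<open>
  The symbolic powers of \<open>I = ideal_of_points Z\<close>, for a finite set of points \<open>Z\<close>, are
  defined in terms of \<open>Z\<close>; the first one is \<open>I\<close> itself.
\<close>

definition symbolic_power :: "'k::field proj_plane set \<Rightarrow> nat \<Rightarrow> 'k poly3 set" where
  "symbolic_power Z m = (\<Inter>q\<in>Z. ideal_power (point_ideal q) m)"

lemma ideal_power_1:
  assumes "rmod.subspace I"
  shows "ideal_power I 1 = I"
proof -
  have "{a * b | a b. a \<in> I \<and> b \<in> UNIV} = I"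
  proof safe
    fix a b :: 'a assume "a \<in> I"
    then show "a * b \<in> I" using rmod.subspace_scale[OF assms] by (metis mult.commute)
  next
    fix x :: 'a assume "x \<in> I"
    then show "\<exists>a b. x = a * b \<and> a \<in> I \<and> b \<in> UNIV" by (metis UNIV_I mult_1_right)
  qed
  then show ?thesis using assms by (simp add: ideal_mult_def)
qed

lemma symbolic_power_1: "symbolic_power Z 1 = ideal_of_points Z"
  unfolding symbolic_power_def ideal_of_points_def point_ideal_def
  by (simp only: ideal_power_1 rmod.subspace_span)

definition almost_collinear :: "'k::field proj_plane set \<Rightarrow> bool" where
  "almost_collinear Z \<longleftrightarrow>
     (\<exists>n\<ge>2. \<exists>p :: nat \<Rightarrow> 'k proj_plane. \<exists>L.
        inj_on p {0..n} \<and> Z = p ` {0..n} \<and>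
        is_line L \<and> p ` {1..n} \<subseteq> L \<and> p 0 \<notin> L)"

definition nearly_complete_intersection :: "'k::field proj_plane set \<Rightarrow> bool" where
  "nearly_complete_intersection Z \<longleftrightarrow>
     (\<exists>n\<ge>1. \<exists>p :: nat \<Rightarrow> 'k proj_plane. \<exists>L1 L2.
        inj_on p {0..2 * n} \<and> Z = p ` {0..2 * n} \<and>
        is_line L1 \<and> is_line L2 \<and> L1 \<noteq> L2 \<and> L1 \<inter> L2 = {p 0} \<and>
        p ` {1..n} \<subseteq> L1 - L2 \<and> p ` {n + 1..2 * n} \<subseteq> L2 - L1)"

end

theory Submission
  imports Defs "HOL-Computational_Algebra.Polynomial" "HOL-Analysis.Cartesian_Space"
begin

text \<open>
  Choose linear coordinates \<open>u, v, w\<close> on the plane, dual to three points \<open>a, b, c\<close>, and let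
  \<open>S\<close>, \<open>T\<close> be finite sets of scalars.

  For an almost collinear scheme let \<open>p\<^sub>0 = a\<close> and let \<open>L\<close> be the line \<open>u = 0\<close>. As \<open>K\<close> is
  infinite, \<open>c\<close> can be chosen on \<open>L\<close> outside the scheme, so that the other points are \<open>b + s c\<close>
  for \<open>s \<in> S\<close>, with ideals \<open>(u, w - s v)\<close>. Put \<open>F = \<Prod> (w - s v)\<close> and \<open>n = card S\<close>. Write
  \<open>f = \<Sum> u\<^sup>i g\<^sub>i\<close> with \<open>g\<^sub>i \<in> K[v, w]\<close>. If \<open>f\<close> lies in the \<open>N\<close>-th symbolic power, then \<open>F\<close> to
  the power \<open>N - i\<close> divides \<open>g\<^sub>i\<close>, and \<open>g\<^sub>i\<close> has order at least \<open>N\<close> at the origin. Hence \<open>f\<close>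
  lies in the ideal generated by the products \<open>u\<^sup>i F\<^sup>j G\<close> with \<open>G \<in> (v, w)\<^sup>k\<close>, \<open>i + j \<ge> N\<close> and
  \<open>k + n j \<ge> N\<close> (\<open>symbolic_power_almost_collinear\<close>).

  For a nearly complete intersection let \<open>p\<^sub>0 = c\<close> and let the lines be \<open>u = 0\<close> and \<open>v = 0\<close>,
  with points \<open>b + s c\<close> and \<open>a + t c\<close>, where \<open>s \<in> S\<close>, \<open>t \<in> T\<close> and \<open>card S = card T = n\<close>. The
  form \<open>F = \<Prod> (w - s v) + \<Prod> (w - t u) - w\<^sup>n\<close> is monic in \<open>w\<close> and restricts on each of the two
  lines to the equation of the points on it other than \<open>p\<^sub>0\<close>. So an element \<open>f\<close> of the \<open>N\<close>-th
  symbolic power lies in \<open>(u, F)\<^sup>N\<close>, \<open>(v, F)\<^sup>N\<close> and \<open>(u, v)\<^sup>N\<close>. The polynomial ring is free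
  over \<open>K[u, v, F]\<close> on the powers of \<open>w\<close> below \<open>w\<^sup>n\<close>, so these three ideals behave like
  monomial ideals. Repeated division by \<open>F\<close> shows that \<open>f\<close> is in the ideal generated by the
  monomials \<open>u\<^sup>i v\<^sup>j F\<^sup>k\<close> whose exponents have all pairwise sums at least \<open>N\<close>
  (\<open>symbolic_power_nearly_complete\<close>).

  It remains to split such a product into \<open>t\<close> factors of the same kind for \<open>m\<close> and a remaining
  factor in \<open>M\<^sup>t\<close> or \<open>M\<close> to the power \<open>t - 1\<close>. Take all \<open>t\<close> factors equal, with the exponents
  divided by \<open>t\<close> and rounded down. If \<open>N \<ge> t (m + 1) - 1\<close>, every required sum of quotients is
  still at least \<open>m\<close>. If all these sums exceed \<open>m\<close>, one quotient can be lowered by one, which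
  frees \<open>t\<close> factors in \<open>M\<close>. If one of them equals \<open>m\<close>, the remainders belonging to it supply
  enough such factors (\<open>split_exponents_3\<close>). In the almost collinear case the form \<open>G\<close> has to be
  decomposed too, and the case distinction is slightly finer (\<open>split_exponents_form\<close>).
\<close>

text \<open>
  The ring interpretation of modules makes \<open>a * (b * c) = a * b * c\<close> a rewrite rule, which loops
  with \<open>algebra_simps\<close>.
\<close>

declare rmod.scale_scale [simp del]

section \<open>Products and powers of ideals\<close>

lemma mem_ideal_mult: "a \<in> I \<Longrightarrow> b \<in> J \<Longrightarrow> a * b \<in> ideal_mult I J"
  unfolding ideal_mult_def by (rule rmod.span_base) auto

lemma subspace_ideal_mult: "rmod.subspace (ideal_mult I J)"
  unfolding ideal_mult_def by (rule rmod.subspace_span)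

lemma ideal_mult_least:
  assumes "rmod.subspace S" "\<And>a b. a \<in> I \<Longrightarrow> b \<in> J \<Longrightarrow> a * b \<in> S"
  shows "ideal_mult I J \<subseteq> S"
proof -
  have "{a * b | a b. a \<in> I \<and> b \<in> J} \<subseteq> S" using assms(2) by auto
  then show ?thesis unfolding ideal_mult_def using assms(1) by (rule rmod.span_minimal)
qed

lemma ideal_mult_mono: "I \<subseteq> I' \<Longrightarrow> J \<subseteq> J' \<Longrightarrow> ideal_mult I J \<subseteq> ideal_mult I' J'"
  by (rule ideal_mult_least[OF subspace_ideal_mult]) (simp add: mem_ideal_mult subset_iff)

lemma ideal_scale: "rmod.subspace I \<Longrightarrow> a \<in> I \<Longrightarrow> r * a \<in> I"
  by (rule rmod.subspace_scale)

lemma ideal_scale': "rmod.subspace I \<Longrightarrow> a \<in> I \<Longrightarrow> a * r \<in> I"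
  by (subst mult.commute) (rule ideal_scale)

text \<open>
  The colon ideal \<open>S : c\<close>. A containment in \<open>S\<close> of products with \<open>c\<close> is checked on generators
  of the other factor by means of it.
\<close>

lemma subspace_colon:
  fixes c :: "'r::comm_ring_1"
  assumes "rmod.subspace S"
  shows "rmod.subspace {a. a * c \<in> S}"
  by (rule rmod.subspaceI)
    (use rmod.subspace_0[OF assms] rmod.subspace_add[OF assms] ideal_scale[OF assms] in
      \<open>simp_all add: distrib_right mult.assoc\<close>)

lemma ideal_mult_commute: "ideal_mult I J = ideal_mult J I"
proof -
  have "{a * b | a b. a \<in> I \<and> b \<in> J} = {a * b | a b. a \<in> J \<and> b \<in> I}"
    by (auto simp: mult.commute) (force simp: mult.commute)+
  then show ?thesis unfolding ideal_mult_def by (rule arg_cong)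
qed

lemma ideal_mult_assoc_subset:
  "ideal_mult (ideal_mult I J) H \<subseteq> ideal_mult I (ideal_mult J H)"
proof (rule ideal_mult_least[OF subspace_ideal_mult])
  fix a b assume a: "a \<in> ideal_mult I J" and b: "b \<in> H"
  have "ideal_mult I J \<subseteq> {a. a * b \<in> ideal_mult I (ideal_mult J H)}"
  proof (rule ideal_mult_least[OF subspace_colon[OF subspace_ideal_mult]])
    fix x y assume "x \<in> I" "y \<in> J"
    then have "x * (y * b) \<in> ideal_mult I (ideal_mult J H)"
      by (intro mem_ideal_mult b)
    then show "x * y \<in> {a. a * b \<in> ideal_mult I (ideal_mult J H)}"
      by (simp add: mult.assoc)
  qed
  with a show "a * b \<in> ideal_mult I (ideal_mult J H)" by blast
qed

lemma ideal_mult_assoc: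
  "ideal_mult (ideal_mult I J) H = ideal_mult I (ideal_mult J H)"
proof
  show "ideal_mult I (ideal_mult J H) \<subseteq> ideal_mult (ideal_mult I J) H"
    using ideal_mult_assoc_subset[of H J I] by (simp only: ideal_mult_commute)
qed (rule ideal_mult_assoc_subset)

lemma ideal_mult_UNIV: "rmod.subspace J \<Longrightarrow> ideal_mult UNIV J = J"
proof
  assume "rmod.subspace J"
  then show "ideal_mult UNIV J \<subseteq> J" by (rule ideal_mult_least) (simp_all add: ideal_scale \<open>rmod.subspace J\<close>)
  show "J \<subseteq> ideal_mult UNIV J" using mem_ideal_mult[of 1 UNIV _ J] by auto
qed

lemma subspace_ideal_power: "rmod.subspace (ideal_power I n)"
  by (cases n) (auto simp: subspace_ideal_mult)

lemma ideal_power_add: "ideal_power I (a + b) = ideal_mult (ideal_power I a) (ideal_power I b)"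
  by (induction a) (simp_all add: ideal_mult_UNIV subspace_ideal_power ideal_mult_assoc)

lemma ideal_mult_subset_right: "rmod.subspace J \<Longrightarrow> ideal_mult I J \<subseteq> J"
  by (rule ideal_mult_least) (simp_all add: ideal_scale)

lemma ideal_power_antimono: "a \<le> b \<Longrightarrow> ideal_power I b \<subseteq> ideal_power I a"
  using ideal_mult_subset_right[OF subspace_ideal_power[of I a], of "ideal_power I (b - a)"]
  by (simp flip: ideal_power_add)

lemma ideal_power_mono: "I \<subseteq> J \<Longrightarrow> ideal_power I n \<subseteq> ideal_power J n"
  by (induction n) (simp_all add: ideal_mult_mono)

lemma power_mem_ideal_power: "a \<in> I \<Longrightarrow> a ^ n \<in> ideal_power I n"
  by (induction n) (auto intro: mem_ideal_mult)

lemma mult_mem_ideal_power: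
  "a \<in> ideal_power I i \<Longrightarrow> b \<in> ideal_power I j \<Longrightarrow> n \<le> i + j \<Longrightarrow> a * b \<in> ideal_power I n"
  using mem_ideal_mult[of a "ideal_power I i" b "ideal_power I j"] ideal_power_antimono[of n "i + j" I]
  by (auto simp flip: ideal_power_add)

lemma power_mult_mem_ideal_power:
  "a \<in> I \<Longrightarrow> b \<in> I \<Longrightarrow> n \<le> i + j \<Longrightarrow> a ^ i * b ^ j \<in> ideal_power I n"
  by (rule mult_mem_ideal_power[OF power_mem_ideal_power power_mem_ideal_power])

lemma ideal_power_mult_subset: "ideal_power I (t * d) \<subseteq> ideal_power (ideal_power I d) t"
  by (induction t) (simp_all add: ideal_power_add ideal_mult_mono)

text \<open>
  If \<open>c J \<subseteq> S\<close> then \<open>c\<^sup>t J\<^sup>t \<subseteq> S\<^sup>t\<close>.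
\<close>

lemma ideal_power_translate:
  assumes "\<And>g. g \<in> J \<Longrightarrow> c * g \<in> S" and "g \<in> ideal_power J t"
  shows "c ^ t * g \<in> ideal_power S t"
  using assms(2)
proof (induction t arbitrary: g)
  case (Suc t)
  have "ideal_mult J (ideal_power J t) \<subseteq> {g. g * c ^ Suc t \<in> ideal_power S (Suc t)}"
  proof (rule ideal_mult_least[OF subspace_colon[OF subspace_ideal_power]])
    fix a b assume "a \<in> J" "b \<in> ideal_power J t"
    then have "(c * a) * (c ^ t * b) \<in> ideal_mult S (ideal_power S t)"
      by (intro mem_ideal_mult Suc.IH assms(1))
    then show "a * b \<in> {g. g * c ^ Suc t \<in> ideal_power S (Suc t)}"
      by (simp add: mult_ac)
  qed
  with Suc.prems show ?case by (auto simp: mult.commute)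
qed simp

lemma ideal_power_span_Suc_split:
  assumes "f \<in> ideal_power (rmod.span {x, y}) (Suc n)"
  obtains g h where "g \<in> ideal_power (rmod.span {x, y}) n" "h \<in> ideal_power (rmod.span {x, y}) n"
    "f = x * g + y * h"
proof -
  let ?P = "ideal_power (rmod.span {x, y}) n"
  let ?S = "{x * g + y * h | g h. g \<in> ?P \<and> h \<in> ?P}"
  have P: "rmod.subspace ?P" by (rule subspace_ideal_power)
  have S: "rmod.subspace ?S"
  proof (rule rmod.subspaceI)
    show "0 \<in> ?S" using rmod.subspace_0[OF P] by force
  next
    fix a b assume "a \<in> ?S" "b \<in> ?S"
    then obtain g h g' h' where "g \<in> ?P" "h \<in> ?P" "a = x * g + y * h" "g' \<in> ?P" "h' \<in> ?P" "b = x * g' + y * h'"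
      by blast
    then have "a + b = x * (g + g') + y * (h + h')" "g + g' \<in> ?P" "h + h' \<in> ?P"
      by (auto simp: algebra_simps intro: rmod.subspace_add[OF P])
    then show "a + b \<in> ?S" by blast
  next
    fix c a assume "a \<in> ?S"
    then obtain g h where "g \<in> ?P" "h \<in> ?P" "a = x * g + y * h" by blast
    then have "c * a = x * (c * g) + y * (c * h)" "c * g \<in> ?P" "c * h \<in> ?P"
      by (auto simp: algebra_simps intro: ideal_scale[OF P])
    then show "c * a \<in> ?S" by blast
  qed
  have "ideal_power (rmod.span {x, y}) (Suc n) \<subseteq> ?S"
    unfolding ideal_power.simps
  proof (rule ideal_mult_least[OF S])
    fix a b assume a: "a \<in> rmod.span {x, y}" and b: "b \<in> ?P"
    have 0: "0 \<in> ?P" using rmod.subspace_0[OF P] .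
    have "rmod.span {x, y} \<subseteq> {a. a * b \<in> ?S}"
    proof (rule rmod.span_minimal[OF _ subspace_colon[OF S]])
      have "x * b + y * 0 \<in> ?S" "x * 0 + y * b \<in> ?S" using b 0 by blast+
      then show "{x, y} \<subseteq> {a. a * b \<in> ?S}" by simp
    qed
    with a show "a * b \<in> ?S" by blast
  qed
  then have "f \<in> ?S" using assms by (rule subsetD)
  then show ?thesis using that by auto
qed

lemma span2_combination: "x * g + y * h \<in> rmod.span {x, y :: 'r::comm_ring_1}"
  by (intro rmod.span_add ideal_scale'[OF rmod.subspace_span] rmod.span_base) auto

text \<open>
  \<open>(x, y)\<^sup>n\<close> is generated by \<open>x\<^sup>n\<close> modulo \<open>y\<close> times the power \<open>n - 1\<close>. For \<open>n = 0\<close> the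
  truncated difference is harmless, since the zeroth power is the whole ring.
\<close>

lemma span2_power_split:
  assumes "f \<in> ideal_power (rmod.span {x, y}) n"
  obtains g h where "g \<in> ideal_power (rmod.span {x, y}) (n - 1)" "f = y * g + x ^ n * h"
  using assms
proof (induction n arbitrary: f thesis)
  case 0
  from "0.prems"(1)[of 0 f] show ?case by simp
next
  case (Suc n)
  obtain g h where gh: "g \<in> ideal_power (rmod.span {x, y}) n" "h \<in> ideal_power (rmod.span {x, y}) n"
    "f = x * g + y * h" by (rule ideal_power_span_Suc_split[OF Suc.prems(2)])
  from Suc.IH[OF _ gh(1)] obtain g1 h1 where 1: "g1 \<in> ideal_power (rmod.span {x, y}) (n - 1)"
    "g = y * g1 + x ^ n * h1" by blast
  have "x \<in> rmod.span {x, y}" by (auto intro: rmod.span_base)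
  then have "x * g1 \<in> ideal_power (rmod.span {x, y}) n"
    using mult_mem_ideal_power[of x "rmod.span {x, y}" 1 g1 "n - 1" n] 1(1)
      ideal_power_1[OF rmod.subspace_span, of "{x, y}"] by (simp del: ideal_power.simps)
  then have "x * g1 + h \<in> ideal_power (rmod.span {x, y}) n"
    using gh(2) by (intro rmod.subspace_add[OF subspace_ideal_power])
  moreover have "f = y * (x * g1 + h) + x ^ Suc n * h1"
    unfolding gh(3) 1(2) by (simp add: algebra_simps)
  ultimately show ?case using Suc.prems(1)[of "x * g1 + h" h1] by simp
qed

section \<open>Ring homomorphisms\<close>

text \<open>Unital homomorphisms of commutative rings, given on the whole type.\<close>

definition is_ring_hom :: "('a::comm_ring_1 \<Rightarrow> 'b::comm_ring_1) \<Rightarrow> bool" where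
  "is_ring_hom h \<longleftrightarrow> h 1 = 1 \<and> (\<forall>a b. h (a + b) = h a + h b) \<and> (\<forall>a b. h (a * b) = h a * h b)"

context
  fixes h :: "'a::comm_ring_1 \<Rightarrow> 'b::comm_ring_1"
  assumes h: "is_ring_hom h"
begin

lemma hom_1: "h 1 = 1" and hom_add: "h (a + b) = h a + h b" and hom_mult: "h (a * b) = h a * h b"
  using h by (auto simp: is_ring_hom_def)

lemma hom_0: "h 0 = 0" using hom_add[of 0 0] by simp

lemma hom_uminus: "h (- a) = - h a"
  using hom_add[of a "-a"] hom_0 by (simp add: add_eq_0_iff)

lemma hom_diff: "h (a - b) = h a - h b"
  using hom_add[of a "-b"] hom_uminus by simp

lemma hom_power: "h (a ^ n) = h a ^ n"
  by (induction n) (simp_all add: hom_1 hom_mult)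

lemma hom_sum: "h (sum f A) = (\<Sum>a\<in>A. h (f a))"
  by (induction A rule: infinite_finite_induct) (simp_all add: hom_0 hom_add)

lemma hom_prod: "h (prod f A) = (\<Prod>a\<in>A. h (f a))"
  by (induction A rule: infinite_finite_induct) (simp_all add: hom_1 hom_mult)

lemma subspace_hom_vimage: "rmod.subspace S \<Longrightarrow> rmod.subspace {f. h f \<in> S}"
  by (auto simp: rmod.subspace_def hom_0 hom_add hom_mult)

lemma hom_span: "f \<in> rmod.span A \<Longrightarrow> h ` A \<subseteq> S \<Longrightarrow> rmod.subspace S \<Longrightarrow> h f \<in> S"
  using rmod.span_minimal[of A "{f. h f \<in> S}"] subspace_hom_vimage by blast

lemma hom_ideal_power: "f \<in> ideal_power I n \<Longrightarrow> h ` I \<subseteq> J \<Longrightarrow> h f \<in> ideal_power J n"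
proof (induction n arbitrary: f)
  case (Suc n)
  have "ideal_mult I (ideal_power I n) \<subseteq> {f. h f \<in> ideal_mult J (ideal_power J n)}"
    using Suc by (intro ideal_mult_least subspace_hom_vimage subspace_ideal_mult)
      (auto simp: hom_mult intro!: mem_ideal_mult)
  with Suc.prems show ?case by auto
qed simp

lemma hom_ideal_power_span:
  "f \<in> ideal_power (rmod.span A) n \<Longrightarrow> h f \<in> ideal_power (rmod.span (h ` A)) n"
  using hom_span[of _ A "rmod.span (h ` A)"] rmod.span_superset[of "h ` A"]
  by (intro hom_ideal_power[of f "rmod.span A"]) (auto simp: rmod.subspace_span)

end

text \<open>The value at \<open>x\<close> of the polynomial obtained by applying \<open>h\<close> to the coefficients.\<close>

definition poly_eval :: "('a::comm_ring_1 \<Rightarrow> 'b::comm_ring_1) \<Rightarrow> 'b \<Rightarrow> 'a poly \<Rightarrow> 'b" where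
  "poly_eval h x p = poly (map_poly h p) x"

lemma poly_eval_pCons: "is_ring_hom h \<Longrightarrow> poly_eval h x (pCons a p) = h a + x * poly_eval h x p"
  by (simp add: poly_eval_def map_poly_pCons hom_0)

lemma poly_eval_0: "poly_eval h x 0 = 0"
  by (simp add: poly_eval_def)

lemma is_ring_hom_poly_eval:
  assumes h: "is_ring_hom h"
  shows "is_ring_hom (poly_eval h x)"
proof -
  note [simp] = poly_eval_pCons[OF h] poly_eval_0 hom_0[OF h] hom_1[OF h] hom_add[OF h] hom_mult[OF h]
  have add: "poly_eval h x (p + q) = poly_eval h x p + poly_eval h x q" for p q
    by (induction p q rule: poly_induct2) (simp_all add: algebra_simps)
  have smult: "poly_eval h x (smult a q) = h a * poly_eval h x q" for a q
    by (induction q) (simp_all add: algebra_simps)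
  have "poly_eval h x (p * q) = poly_eval h x p * poly_eval h x q" for p q
    by (induction p) (simp_all add: add smult algebra_simps)
  with add show ?thesis by (simp add: is_ring_hom_def one_pCons)
qed

section \<open>Substitution into polynomials\<close>

text \<open>
  The value of the monomial with exponent vector \<open>e\<close> when the variable \<open>i\<close> takes the value
  \<open>x i\<close>.
\<close>

definition monomial_val :: "(3 \<Rightarrow> 'r) \<Rightarrow> (3 \<Rightarrow>\<^sub>0 nat) \<Rightarrow> 'r::comm_ring_1" where
  "monomial_val x e = (\<Prod>i\<in>UNIV. x i ^ Poly_Mapping.lookup e i)"

text \<open>Substitution of \<open>x\<close> for the variables, with coefficients mapped by \<open>h\<close>.\<close>

definition subst :: "('k::comm_ring_1 \<Rightarrow> 'r::comm_ring_1) \<Rightarrow> (3 \<Rightarrow> 'r) \<Rightarrow> 'k poly3 \<Rightarrow> 'r" where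
  "subst h x f = (\<Sum>e\<in>Poly_Mapping.keys f. h (Poly_Mapping.lookup f e) * monomial_val x e)"

text \<open>Constant polynomials; the zero exponent vector is \<open>0 :: 3 \<Rightarrow>\<^sub>0 nat\<close>.\<close>

definition const :: "'k::comm_ring_1 \<Rightarrow> 'k poly3" where
  "const c = Poly_Mapping.single 0 c"

lemma eval_at_eq_subst: "eval_at f v = subst (\<lambda>c. c) (\<lambda>i. v $ i) f"
  by (simp add: eval_at_def subst_def monomial_val_def)

lemma monomial_val_add: "monomial_val x (d + e) = monomial_val x d * monomial_val x e"
  by (simp add: monomial_val_def lookup_add power_add prod.distrib)

lemma monomial_val_0: "monomial_val x 0 = 1"
  by (simp add: monomial_val_def)

lemma hom_monomial_val: "is_ring_hom h \<Longrightarrow> h (monomial_val x e) = monomial_val (\<lambda>i. h (x i)) e"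
  by (simp add: monomial_val_def hom_prod hom_power)

lemma poly_mapping_as_sum:
  "(\<Sum>e\<in>Poly_Mapping.keys f. Poly_Mapping.single e (Poly_Mapping.lookup f e)) = f"
proof (rule poly_mapping_eqI)
  fix e
  show "Poly_Mapping.lookup (\<Sum>e\<in>Poly_Mapping.keys f. Poly_Mapping.single e (Poly_Mapping.lookup f e)) e
    = Poly_Mapping.lookup f e"
    by (cases "e \<in> Poly_Mapping.keys f")
      (simp_all add: lookup_sum lookup_single when_def sum.delta in_keys_iff)
qed

lemma is_ring_hom_const: "is_ring_hom const"
  by (simp add: is_ring_hom_def const_def single_add mult_single)

context
  fixes h :: "'k::comm_ring_1 \<Rightarrow> 'r::comm_ring_1"
  assumes h: "is_ring_hom h"
begin

lemma subst_superset:
  assumes "finite A" "Poly_Mapping.keys f \<subseteq> A"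
  shows "subst h x f = (\<Sum>e\<in>A. h (Poly_Mapping.lookup f e) * monomial_val x e)"
  unfolding subst_def
  by (rule sum.mono_neutral_left) (use assms in \<open>auto simp: in_keys_iff hom_0[OF h]\<close>)

lemma subst_add: "subst h x (f + g) = subst h x f + subst h x g"
proof -
  let ?A = "Poly_Mapping.keys f \<union> Poly_Mapping.keys g"
  have "subst h x (f + g) = (\<Sum>e\<in>?A. h (Poly_Mapping.lookup (f + g) e) * monomial_val x e)"
    by (rule subst_superset) (simp_all add: Poly_Mapping.keys_add)
  also have "\<dots> = (\<Sum>e\<in>?A. h (Poly_Mapping.lookup f e) * monomial_val x e)
      + (\<Sum>e\<in>?A. h (Poly_Mapping.lookup g e) * monomial_val x e)"
    by (simp add: lookup_add hom_add[OF h] distrib_right sum.distrib)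
  also have "\<dots> = subst h x f + subst h x g"
    by (simp add: subst_superset[of ?A])
  finally show ?thesis .
qed

lemma subst_single: "subst h x (Poly_Mapping.single e c) = h c * monomial_val x e"
  by (subst subst_superset[of "{e}"]) auto

lemma subst_0: "subst h x 0 = 0"
  by (simp add: subst_def)

lemma subst_sum: "subst h x (sum f A) = (\<Sum>a\<in>A. subst h x (f a))"
  by (induction A rule: infinite_finite_induct) (simp_all add: subst_0 subst_add)

lemma subst_mult: "subst h x (f * g) = subst h x f * subst h x g"
proof -
  let ?s = "\<lambda>f e. Poly_Mapping.single e (Poly_Mapping.lookup f e)"
  have "f * g = (\<Sum>d\<in>Poly_Mapping.keys f. \<Sum>e\<in>Poly_Mapping.keys g. ?s f d * ?s g e)"
    by (simp add: poly_mapping_as_sum flip: sum_product)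
  then have "subst h x (f * g) = (\<Sum>d\<in>Poly_Mapping.keys f. \<Sum>e\<in>Poly_Mapping.keys g.
      (h (Poly_Mapping.lookup f d) * monomial_val x d) * (h (Poly_Mapping.lookup g e) * monomial_val x e))"
    by (simp add: subst_sum mult_single subst_single hom_mult[OF h] monomial_val_add mult_ac)
  then show ?thesis by (simp add: subst_def sum_product)
qed

lemma is_ring_hom_subst: "is_ring_hom (subst h x)"
  unfolding is_ring_hom_def
proof (intro conjI allI subst_add subst_mult)
  show "subst h x 1 = 1"
    using subst_single[of x 0 1] by (simp add: hom_1[OF h] monomial_val_0)
qed

lemma subst_const: "subst h x (const c) = h c"
  by (simp add: const_def subst_single monomial_val_0)

lemma subst_var: "subst h x (var i) = x i"
proof -
  have "monomial_val x (Poly_Mapping.single i 1) = (\<Prod>j\<in>UNIV. if j = i then x j else 1)"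
    unfolding monomial_val_def by (rule prod.cong) (auto simp: lookup_single)
  then show ?thesis by (simp add: var_def subst_single hom_1[OF h])
qed

end

lemma monomial_val_var: "monomial_val var e = (Poly_Mapping.single e 1 :: 'k::comm_ring_1 poly3)"
proof -
  have pow: "var i ^ n = (Poly_Mapping.single (Poly_Mapping.single i n) 1 :: 'k poly3)" for i n
    by (induction n) (simp_all add: var_def mult_single flip: single_add)
  have prod: "(\<Prod>i\<in>A. Poly_Mapping.single (m i) (1::'k)) = Poly_Mapping.single (sum m A) 1"
    if "finite A" for A and m :: "3 \<Rightarrow> (3 \<Rightarrow>\<^sub>0 nat)"
    using that by (induction A) (simp_all add: mult_single)
  have "(\<Sum>i\<in>UNIV. Poly_Mapping.single i (Poly_Mapping.lookup e i)) = e"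
    by (rule poly_mapping_eqI) (simp add: lookup_sum lookup_single when_def sum.delta)
  then show ?thesis by (simp add: monomial_val_def pow prod)
qed

lemma subst_const_var: "subst const var f = (f :: 'k::comm_ring_1 poly3)"
proof -
  have "const c * monomial_val var e = Poly_Mapping.single e (c::'k)" for c e
    by (simp add: monomial_val_var const_def mult_single)
  then show ?thesis by (simp add: subst_def poly_mapping_as_sum)
qed

lemma hom_subst:
  "is_ring_hom H \<Longrightarrow> H (subst h x f) = subst (\<lambda>c. H (h c)) (\<lambda>i. H (x i)) f"
  by (simp add: subst_def hom_sum hom_mult hom_monomial_val)

lemma is_ring_hom_id: "is_ring_hom (\<lambda>c. c)"
  by (simp add: is_ring_hom_def)

lemma is_ring_hom_eval_at: "is_ring_hom (\<lambda>f. eval_at f v)"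
  using is_ring_hom_subst[OF is_ring_hom_id] by (simp add: eval_at_eq_subst)

lemma eval_at_const: "eval_at (const c) v = c"
  by (simp add: eval_at_eq_subst subst_const is_ring_hom_id)

lemma eval_at_var: "eval_at (var i) v = v $ i"
  by (simp add: eval_at_eq_subst subst_var is_ring_hom_id)

lemmas eval_at_simps = eval_at_const eval_at_var hom_add[OF is_ring_hom_eval_at]
  hom_diff[OF is_ring_hom_eval_at] hom_mult[OF is_ring_hom_eval_at] hom_sum[OF is_ring_hom_eval_at]

lemma eval_at_scale:
  assumes "homogeneous d f"
  shows "eval_at f (c *s v) = c ^ d * eval_at f v"
proof -
  have "monomial_val (\<lambda>i. c * v $ i) e = c ^ (\<Sum>i\<in>UNIV. Poly_Mapping.lookup e i) * monomial_val (\<lambda>i. v $ i) e" for e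
    by (simp add: monomial_val_def power_mult_distrib prod.distrib power_sum)
  with assms show ?thesis
    by (simp add: eval_at_eq_subst subst_def homogeneous_def sum_distrib_left mult_ac)
qed

section \<open>Linear forms and coordinate systems\<close>

lemma homogeneous_1_expand:
  assumes "homogeneous 1 l"
  obtains c where "l = (\<Sum>i\<in>UNIV. const (c i) * var i)"
proof
  let ?c = "\<lambda>i. Poly_Mapping.lookup l (Poly_Mapping.single i 1)"
  have "l = (\<Sum>i\<in>UNIV. Poly_Mapping.single (Poly_Mapping.single i 1) (?c i))"
  proof (rule poly_mapping_eqI)
    fix e
    show "Poly_Mapping.lookup l e
      = Poly_Mapping.lookup (\<Sum>i\<in>UNIV. Poly_Mapping.single (Poly_Mapping.single i 1) (?c i)) e"
    proof (cases "\<exists>i. e = Poly_Mapping.single i 1")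
      case True
      then obtain j where e: "e = Poly_Mapping.single j 1" by blast
      have "Poly_Mapping.single i (1::nat) = Poly_Mapping.single j 1 \<longleftrightarrow> i = j" for i j :: 3
        by (metis lookup_single_eq lookup_single_not_eq zero_neq_one)
      then show ?thesis by (simp add: e lookup_sum lookup_single when_def sum.delta)
    next
      case False
      have "e \<notin> Poly_Mapping.keys l"
      proof
        assume "e \<in> Poly_Mapping.keys l"
        with assms have "(\<Sum>i\<in>UNIV. Poly_Mapping.lookup e i) = 1" by (auto simp: homogeneous_def)
        then obtain j where "Poly_Mapping.lookup e j = 1" "\<And>i. i \<noteq> j \<Longrightarrow> Poly_Mapping.lookup e i = 0"
          unfolding sum_eq_1_iff[OF finite_class.finite_UNIV] by fastforce
        then have "e = Poly_Mapping.single j 1"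
          by (intro poly_mapping_eqI) (auto simp: lookup_single when_def)
        with False show False by blast
      qed
      moreover have "Poly_Mapping.lookup (Poly_Mapping.single (Poly_Mapping.single i 1) (?c i)) e = 0" for i
        using False by (auto simp: lookup_single when_def)
      ultimately show ?thesis by (simp add: lookup_sum in_keys_iff)
    qed
  qed
  also have "\<dots> = (\<Sum>i\<in>UNIV. const (?c i) * var i)"
    by (simp add: const_def var_def mult_single)
  finally show "l = (\<Sum>i\<in>UNIV. const (?c i) * var i)" .
qed

lemma homogeneous_sum:
  assumes "\<And>i. i \<in> A \<Longrightarrow> homogeneous d (f i)"
  shows "homogeneous d (\<Sum>i\<in>A. f i)"
  unfolding homogeneous_def
proof
  fix e assume "e \<in> Poly_Mapping.keys (\<Sum>i\<in>A. f i)"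
  then have "(\<Sum>i\<in>A. Poly_Mapping.lookup (f i) e) \<noteq> 0" by (simp add: in_keys_iff lookup_sum)
  then obtain i where "i \<in> A" "Poly_Mapping.lookup (f i) e \<noteq> 0" by (meson sum.not_neutral_contains_not_neutral)
  with assms show "(\<Sum>i\<in>UNIV. Poly_Mapping.lookup e i) = d"
    by (auto simp: homogeneous_def in_keys_iff)
qed

lemma homogeneous_linear_combination: "homogeneous 1 (\<Sum>i\<in>UNIV. const (c i) * var i)"
proof (rule homogeneous_sum)
  fix i
  show "homogeneous 1 (const (c i) * var i)"
    by (auto simp: homogeneous_def const_def var_def mult_single lookup_single when_def split: if_splits)
qed

lemma linear_add:
  assumes "homogeneous 1 l"
  shows "eval_at l (v + w) = eval_at l v + eval_at l w"
proof -
  obtain c where "l = (\<Sum>i\<in>UNIV. const (c i) * var i)" using homogeneous_1_expand[OF assms] .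
  then show ?thesis by (simp add: eval_at_simps distrib_left sum.distrib)
qed

lemma linear_scale: "homogeneous 1 l \<Longrightarrow> eval_at l (s *s v) = s * eval_at l v"
  using eval_at_scale[of 1 l s v] by simp

lemma linear_0: "homogeneous 1 l \<Longrightarrow> eval_at l 0 = 0"
  using linear_scale[of l 0 0] by simp

text \<open>
  A basis \<open>a, b, c\<close> of \<open>K\<^sup>3\<close> together with the dual basis \<open>u, v, w\<close> of the linear forms. The
  last clause expresses the original variables in the new ones.
\<close>

definition coord_sys ::
  "'k::field ^ 3 \<Rightarrow> 'k ^ 3 \<Rightarrow> 'k ^ 3 \<Rightarrow> 'k poly3 \<Rightarrow> 'k poly3 \<Rightarrow> 'k poly3 \<Rightarrow> bool" where
  "coord_sys a b c u v w \<longleftrightarrow>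
     homogeneous 1 u \<and> homogeneous 1 v \<and> homogeneous 1 w \<and>
     eval_at u a = 1 \<and> eval_at u b = 0 \<and> eval_at u c = 0 \<and>
     eval_at v a = 0 \<and> eval_at v b = 1 \<and> eval_at v c = 0 \<and>
     eval_at w a = 0 \<and> eval_at w b = 0 \<and> eval_at w c = 1 \<and>
     (\<forall>i. var i = const (a $ i) * u + const (b $ i) * v + const (c $ i) * w)"

lemma coord_sys_swap: "coord_sys a b c u v w \<Longrightarrow> coord_sys b a c v u w"
  unfolding coord_sys_def by (simp add: add.commute)

lemma coord_sys_rotate: "coord_sys a b c u v w \<Longrightarrow> coord_sys b c a v w u"
  unfolding coord_sys_def by (simp add: add_ac)

lemma homogeneous_1_combination:
  assumes "homogeneous 1 l" "homogeneous 1 l'"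
  shows "homogeneous 1 (l - const s * l')"
proof -
  obtain c where c: "l = (\<Sum>i\<in>UNIV. const (c i) * var i)" using homogeneous_1_expand[OF assms(1)] .
  obtain c' where c': "l' = (\<Sum>i\<in>UNIV. const (c' i) * var i)" using homogeneous_1_expand[OF assms(2)] .
  have "l - const s * l' = (\<Sum>i\<in>UNIV. const (c i - s * c' i) * var i)"
    unfolding c c' by (simp add: hom_diff[OF is_ring_hom_const] hom_mult[OF is_ring_hom_const] sum_distrib_left
        left_diff_distrib sum_subtractf mult.assoc)
  then show ?thesis using homogeneous_linear_combination[of "\<lambda>i. c i - s * c' i"] by simp
qed

text \<open>
  Replacing \<open>b, c\<close> by \<open>c, b + s c\<close> makes an arbitrary point of the line \<open>u = 0\<close> other than \<open>c\<close>
  the last coordinate point.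
\<close>

lemma coord_sys_shear:
  assumes "coord_sys a b c u v w"
  shows "coord_sys a c (b + s *s c) u (w - const s * v) v"
proof -
  have "const (b $ i + s * c $ i) = const (b $ i) + const s * const (c $ i)" for i
    by (simp add: hom_add[OF is_ring_hom_const] hom_mult[OF is_ring_hom_const])
  then show ?thesis
    using assms homogeneous_1_combination[of w v s] unfolding coord_sys_def
    by (simp add: linear_add linear_scale eval_at_simps) (simp add: algebra_simps)
qed

lemma coord_sys_expand:
  assumes "coord_sys a b c u v w"
  shows "p = eval_at u p *s a + eval_at v p *s b + eval_at w p *s c"
proof -
  have "p $ i = a $ i * eval_at u p + b $ i * eval_at v p + c $ i * eval_at w p" for i
  proof -
    have "eval_at (var i) p = eval_at (const (a $ i) * u + const (b $ i) * v + const (c $ i) * w) p"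
      using assms by (simp add: coord_sys_def)
    then show ?thesis by (simp add: eval_at_simps)
  qed
  then show ?thesis by (simp add: vec_eq_iff mult.commute)
qed

lemma coord_sys_exists:
  fixes a b c :: "'k::field ^ 3"
  assumes "\<And>x y z. x *s a + y *s b + z *s c = 0 \<Longrightarrow> x = 0 \<and> y = 0 \<and> z = 0"
  obtains u v w where "coord_sys a b c u v w"
proof -
  define A :: "'k ^ 3 ^ 3" where "A = (\<chi> i k. if k = 1 then a $ i else if k = 2 then b $ i else c $ i)"
  have "\<forall>x. A *v x = 0 \<longrightarrow> x = 0"
  proof safe
    fix x assume "A *v x = 0"
    moreover have "A *v x = x $ 1 *s a + x $ 2 *s b + x $ 3 *s c"
      by (simp add: vec_eq_iff A_def matrix_vector_mult_def sum_3 mult.commute)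
    ultimately have "x $ 1 = 0 \<and> x $ 2 = 0 \<and> x $ 3 = 0" using assms by auto
    then show "x = 0" by (simp add: vec_eq_iff forall_3)
  qed
  then obtain B where BA: "B ** A = mat 1" using matrix_left_invertible_ker by metis
  then have AB: "A ** B = mat 1" using matrix_left_right_inverse1 by blast
  define l where "l k = (\<Sum>j\<in>UNIV. const (B $ k $ j) * var j)" for k
  have hom: "homogeneous 1 (l k)" for k unfolding l_def by (rule homogeneous_linear_combination)
  have ev: "eval_at (l k) (\<chi> i. A $ i $ j) = (if k = j then 1 else 0)" for k j
    using BA[unfolded vec_eq_iff, THEN spec[of _ k], THEN spec[of _ j]]
    by (simp add: l_def eval_at_simps matrix_matrix_mult_def mat_def)
  have cols: "(\<chi> i. A $ i $ 1) = a" "(\<chi> i. A $ i $ 2) = b" "(\<chi> i. A $ i $ 3) = c"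
    by (simp_all add: A_def vec_eq_iff)
  have "var i = (\<Sum>k\<in>UNIV. const (A $ i $ k) * l k)" for i
  proof -
    have "(\<Sum>k\<in>UNIV. const (A $ i $ k) * l k) = (\<Sum>k\<in>UNIV. \<Sum>j\<in>UNIV. const (A $ i $ k * B $ k $ j) * var j)"
      by (simp add: l_def sum_distrib_left hom_mult[OF is_ring_hom_const] mult.assoc)
    also have "\<dots> = (\<Sum>j\<in>UNIV. \<Sum>k\<in>UNIV. const (A $ i $ k * B $ k $ j) * var j)"
      by (rule sum.swap)
    also have "\<dots> = (\<Sum>j\<in>UNIV. const ((A ** B) $ i $ j) * var j)"
      by (simp add: matrix_matrix_mult_def hom_sum[OF is_ring_hom_const] sum_distrib_right)
    also have "\<dots> = (\<Sum>j\<in>UNIV. if j = i then var j else 0)"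
      unfolding AB by (rule sum.cong)
        (auto simp: mat_def hom_0[OF is_ring_hom_const] hom_1[OF is_ring_hom_const])
    finally show ?thesis by simp
  qed
  then have "var i = const (a $ i) * l 1 + const (b $ i) * l 2 + const (c $ i) * l 3" for i
    by (simp add: sum_3 A_def)
  then have "coord_sys a b c (l 1) (l 2) (l 3)"
    unfolding coord_sys_def using hom ev[of _ 1] ev[of _ 2] ev[of _ 3] by (simp add: cols)
  then show ?thesis by (rule that)
qed

text \<open>
  A coordinate system identifies \<open>K[x, y, z]\<close> with the ring of iterated univariate polynomials in
  which \<open>u\<close> is the innermost and \<open>w\<close> the outermost variable.
\<close>

lemma coord_sys_iso:
  fixes w :: "'k::field poly3"
  assumes "coord_sys a b c u v w"
  obtains \<Phi> :: "'k poly3 \<Rightarrow> 'k poly poly poly" and \<Psi> where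
    "is_ring_hom \<Phi>" "is_ring_hom \<Psi>" "\<And>f. \<Psi> (\<Phi> f) = f"
    "\<Phi> u = [:[:[:0, 1:]:]:]" "\<Phi> v = [:[:0, 1:]:]" "\<Phi> w = [:0, 1:]" "\<And>k. \<Phi> (const k) = [:[:[:k:]:]:]"
proof -
  define K :: "'k \<Rightarrow> 'k poly poly poly" where "K k = [:[:[:k:]:]:]" for k
  define \<Psi> where "\<Psi> = poly_eval (poly_eval (poly_eval const u) v) w"
  have h1: "is_ring_hom (poly_eval const u)" by (intro is_ring_hom_poly_eval is_ring_hom_const)
  have h2: "is_ring_hom (poly_eval (poly_eval const u) v)" by (intro is_ring_hom_poly_eval h1)
  have \<Psi>: "is_ring_hom \<Psi>" unfolding \<Psi>_def by (intro is_ring_hom_poly_eval h2)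
  have K: "is_ring_hom K" by (simp add: is_ring_hom_def K_def one_pCons)
  let ?X = "[:[:[:0, 1:]:]:]" and ?Y = "[:[:0, 1:]:]" and ?Z = "[:0, 1:]"
  define x where "x i = K (a $ i) * ?X + K (b $ i) * ?Y + K (c $ i) * ?Z" for i
  define \<Phi> where "\<Phi> = subst K x"
  have \<Phi>: "is_ring_hom \<Phi>" unfolding \<Phi>_def by (rule is_ring_hom_subst[OF K])
  note simps = poly_eval_pCons[OF h2] poly_eval_pCons[OF h1] poly_eval_pCons[OF is_ring_hom_const]
    poly_eval_0 hom_0[OF is_ring_hom_const] hom_1[OF is_ring_hom_const] hom_0[OF h1] hom_1[OF h1]
    hom_0[OF h2] hom_1[OF h2]
  have \<Psi>_vars: "\<Psi> ?X = u" "\<Psi> ?Y = v" "\<Psi> ?Z = w" "\<Psi> (K k) = const k" for k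
    by (simp_all add: \<Psi>_def K_def simps)
  have "\<Psi> (x i) = var i" for i
    using assms unfolding x_def coord_sys_def by (simp only: hom_add[OF \<Psi>] hom_mult[OF \<Psi>] \<Psi>_vars)
  then have inv: "\<Psi> (\<Phi> f) = f" for f
    unfolding \<Phi>_def using hom_subst[OF \<Psi>, of K x f] by (simp add: \<Psi>_vars subst_const_var)
  have \<Phi>_const: "\<Phi> (const k) = K k" for k unfolding \<Phi>_def by (rule subst_const[OF K])
  have linear: "\<Phi> l = K (eval_at l a) * ?X + K (eval_at l b) * ?Y + K (eval_at l c) * ?Z"
    if l: "homogeneous 1 l" for l
  proof -
    obtain q where q: "l = (\<Sum>i\<in>UNIV. const (q i) * var i)" using homogeneous_1_expand[OF l] .
    have "\<Phi> l = (\<Sum>i\<in>UNIV. K (q i) * x i)"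
      unfolding q by (simp add: hom_sum[OF \<Phi>] hom_mult[OF \<Phi>] \<Phi>_const) (simp add: \<Phi>_def subst_var[OF K])
    also have "\<dots> = (\<Sum>i\<in>UNIV. K (q i) * K (a $ i)) * ?X + (\<Sum>i\<in>UNIV. K (q i) * K (b $ i)) * ?Y
        + (\<Sum>i\<in>UNIV. K (q i) * K (c $ i)) * ?Z"
      unfolding sum_distrib_right sum.distrib[symmetric] x_def by (rule sum.cong) (simp_all only: algebra_simps)
    finally show ?thesis by (simp add: q eval_at_simps hom_sum[OF K] hom_mult[OF K])
  qed
  show ?thesis
  proof (rule that[OF \<Phi> \<Psi> inv])
    show "\<Phi> u = ?X" "\<Phi> v = ?Y" "\<Phi> w = ?Z"
      using assms by (simp_all add: coord_sys_def linear hom_0[OF K] hom_1[OF K])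
  qed (simp add: \<Phi>_const K_def)
qed

section \<open>Ideals of points\<close>

lemma point_exists:
  obtains v where "v \<noteq> 0" "p = point v"
proof -
  have "proportional (rep_point p) (rep_point p)" "point (rep_point p) = p"
    using Quotient_proj_plane by (auto simp: Quotient_def)
  then show ?thesis using that by (metis proportional_def)
qed

lemma point_eq_iff: "v \<noteq> 0 \<Longrightarrow> w \<noteq> 0 \<Longrightarrow> point v = point w \<longleftrightarrow> (\<exists>s. s \<noteq> 0 \<and> w = s *s v)"
proof -
  assume nz: "v \<noteq> 0" "w \<noteq> 0"
  have refl: "proportional x x" if "x \<noteq> 0" for x :: "'a ^ 3"
    using that by (auto simp: proportional_def intro!: exI[of _ 1])
  show ?thesis using Quotient_rel[OF Quotient_proj_plane, of v w] refl nz
    by (auto simp: proportional_def)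
qed

lemma vanishes_at_point_iff:
  assumes "homogeneous d f" "v \<noteq> 0"
  shows "vanishes_at f (point v) \<longleftrightarrow> eval_at f v = 0"
proof
  assume "vanishes_at f (point v)"
  then show "eval_at f v = 0" using assms(2) by (simp add: vanishes_at_def coords_def)
next
  assume "eval_at f v = 0"
  then show "vanishes_at f (point v)"
    using assms unfolding vanishes_at_def coords_def
    by (auto simp: point_eq_iff[of v] eq_commute[of "point _" "point v"] eval_at_scale)
qed

lemma congruent_monomial_val:
  assumes J: "rmod.subspace J" and xy: "\<And>i. x i - y i \<in> J"
  shows "monomial_val x e - monomial_val y e \<in> J"
proof -
  have mult: "a * b - a' * b' \<in> J" if "a - a' \<in> J" "b - b' \<in> J" for a a' b b'
  proof -
    have "a * b - a' * b' = (a - a') * b + a' * (b - b')" by (simp add: algebra_simps)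
    with that show ?thesis
      by (simp add: rmod.subspace_add[OF J] ideal_scale[OF J] ideal_scale'[OF J])
  qed
  have pow: "x i ^ n - y i ^ n \<in> J" for i n
    by (induction n) (simp_all add: rmod.subspace_0[OF J] mult xy)
  have "(\<Prod>i\<in>A. x i ^ Poly_Mapping.lookup e i) - (\<Prod>i\<in>A. y i ^ Poly_Mapping.lookup e i) \<in> J" if "finite A" for A
    using that by induction (simp_all add: rmod.subspace_0[OF J] mult pow)
  then show ?thesis by (simp add: monomial_val_def)
qed

text \<open>
  Modulo \<open>(u, v)\<close> every variable is congruent to the corresponding coordinate of \<open>c\<close> times \<open>w\<close>,
  so a form \<open>f\<close> of degree \<open>d\<close> is congruent to \<open>f(c) w\<^sup>d\<close>.
\<close>

lemma point_ideal_eq: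
  assumes cs: "coord_sys a b c u v w"
  shows "point_ideal (point c) = rmod.span {u, v}"
proof
  let ?J = "rmod.span {u, v}"
  have J: "rmod.subspace ?J" by (rule rmod.subspace_span)
  have hom: "homogeneous 1 u" "homogeneous 1 v" "homogeneous 1 w" using cs by (auto simp: coord_sys_def)
  have "eval_at w c = 1" using cs by (simp add: coord_sys_def)
  then have c: "c \<noteq> 0" using linear_0[OF hom(3)] by auto
  show "point_ideal (point c) \<subseteq> ?J"
    unfolding point_ideal_def
  proof (rule rmod.span_minimal[OF _ J], safe)
    fix f d assume f: "homogeneous d f" "vanishes_at f (point c)"
    then have f0: "eval_at f c = 0" using c vanishes_at_point_iff by blast
    define y where "y i = const (c $ i) * w" for i
    have "var i - y i \<in> ?J" for i
    proof -
      have "var i - y i = const (a $ i) * u + const (b $ i) * v"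
        using cs by (simp add: coord_sys_def y_def)
      then show ?thesis using span2_combination[of u "const (a $ i)" v "const (b $ i)"]
        by (simp add: mult.commute)
    qed
    then have "monomial_val var e - monomial_val y e \<in> ?J" for e
      by (rule congruent_monomial_val[OF J])
    then have "subst const var f - subst const y f \<in> ?J"
      unfolding subst_def sum_subtractf[symmetric] right_diff_distrib[symmetric]
      by (intro rmod.subspace_sum[OF J] ideal_scale[OF J]) auto
    moreover have "subst const y f = const (eval_at f c) * w ^ d"
    proof -
      have "monomial_val y e = const (monomial_val (\<lambda>i. c $ i) e) * w ^ d" if "e \<in> Poly_Mapping.keys f" for e
        using that f(1) by (simp add: homogeneous_def hom_monomial_val[OF is_ring_hom_const])
          (auto simp: monomial_val_def y_def power_mult_distrib prod.distrib power_sum)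
      then show ?thesis
        by (simp add: eval_at_eq_subst subst_def hom_sum[OF is_ring_hom_const] hom_mult[OF is_ring_hom_const]
            sum_distrib_right mult.assoc)
    qed
    ultimately show "f \<in> ?J" by (simp add: subst_const_var f0 hom_0[OF is_ring_hom_const])
  qed
  have "u \<in> point_ideal (point c)" "v \<in> point_ideal (point c)"
    unfolding point_ideal_def using hom cs c
    by (auto intro!: rmod.span_base simp: vanishes_at_point_iff coord_sys_def)
  then show "?J \<subseteq> point_ideal (point c)"
    by (intro rmod.span_minimal) (auto simp: point_ideal_def rmod.subspace_span)
qed

section \<open>Ideals of iterated polynomials\<close>

lemma poly_sum_monom: "(\<Sum>k\<le>degree p. [:coeff p k:] * [:0, 1:] ^ k) = (p :: 'a::comm_ring_1 poly)"
  using poly_as_sum_of_monoms[of p] by (simp add: monom_altdef)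

lemma is_ring_hom_pCons: "is_ring_hom (\<lambda>a :: 'a::comm_ring_1. [:a:])"
  by (simp add: is_ring_hom_def one_pCons)

text \<open>
  Membership in a power of the ideal \<open>(Z, x)\<close> of \<open>A[Z]\<close>, where \<open>x \<in> A\<close>, is read off the
  coefficients.
\<close>

lemma coeff_dvd_if_mem_power:
  fixes x :: "'a::comm_ring_1"
  assumes "p \<in> ideal_power (rmod.span {[:0, 1:], [:x:]}) N"
  shows "x ^ (N - k) dvd coeff p k"
  using assms
proof (induction N arbitrary: p k)
  case (Suc N)
  obtain g h where gh: "g \<in> ideal_power (rmod.span {[:0, 1:], [:x:]}) N"
    "h \<in> ideal_power (rmod.span {[:0, 1:], [:x:]}) N" "p = [:0, 1:] * g + [:x:] * h"
    by (rule ideal_power_span_Suc_split[OF Suc.prems])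
  have "x ^ Suc (N - k) dvd x * coeff h k"
    using Suc.IH[OF gh(2), of k] by (simp add: mult_dvd_mono)
  then have h: "x ^ (Suc N - k) dvd x * coeff h k"
    by (rule dvd_trans[rotated]) (rule le_imp_power_dvd, simp)
  show ?case
  proof (cases k)
    case 0
    with h show ?thesis by (simp add: gh(3))
  next
    case (Suc j)
    with Suc.IH[OF gh(1), of j] h show ?thesis by (simp add: gh(3) dvd_add)
  qed
qed simp

lemma mem_power_if_coeff_dvd:
  fixes x :: "'a::comm_ring_1"
  assumes "\<And>k. x ^ (N - k) dvd coeff p k"
  shows "p \<in> ideal_power (rmod.span {[:0, 1:], [:x:]}) N"
proof -
  let ?J = "rmod.span {[:0, 1:], [:x:]}"
  have "[:coeff p k:] * [:0, 1:] ^ k \<in> ideal_power ?J N" for k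
  proof -
    obtain c where c: "coeff p k = x ^ (N - k) * c" using assms[of k] by (auto simp: dvd_def)
    have "[:x:] ^ (N - k) * [:0, 1:] ^ k \<in> ideal_power ?J N"
      by (rule power_mult_mem_ideal_power) (auto intro: rmod.span_base)
    then have "[:c:] * ([:x:] ^ (N - k) * [:0, 1:] ^ k) \<in> ideal_power ?J N"
      by (rule ideal_scale[OF subspace_ideal_power])
    moreover have "[:coeff p k:] = [:c:] * [:x:] ^ (N - k)"
      unfolding c by (simp add: hom_mult[OF is_ring_hom_pCons] hom_power[OF is_ring_hom_pCons] mult.commute)
    ultimately show ?thesis by (simp only: mult.assoc)
  qed
  then have "(\<Sum>k\<le>degree p. [:coeff p k:] * [:0, 1:] ^ k) \<in> ideal_power ?J N"
    by (intro rmod.subspace_sum[OF subspace_ideal_power])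
  then show ?thesis by (simp only: poly_sum_monom)
qed

text \<open>A linear factor \<open>Z - c y\<close> lowers the \<open>(Z, y)\<close>-adic order by at most one.\<close>

lemma coeff_dvd_linear_factor:
  fixes y :: "'a::comm_ring_1"
  assumes "\<And>k. y ^ (N - k) dvd coeff ([:- (c * y), 1:] * h) k"
  shows "y ^ (N - 1 - k) dvd coeff h k"
proof (induction "N - 1 - k" arbitrary: k)
  case 0
  then show ?case by simp
next
  case (Suc d)
  have "y ^ d dvd coeff h (Suc k)" 
  proof -
    have "d = N - 1 - Suc k" using Suc.hyps(2) by linarith
    from Suc.hyps(1)[OF this] this show ?thesis by simp
  qed
  then have "y ^ Suc d dvd c * (y * coeff h (Suc k))" by (simp add: mult_dvd_mono)
  moreover have "coeff ([:- (c * y), 1:] * h) (Suc k) = coeff h k - c * (y * coeff h (Suc k))"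
    by (simp add: mult.assoc)
  then have "y ^ Suc d dvd coeff h k - c * (y * coeff h (Suc k))"
    using assms[of "Suc k"] Suc.hyps(2) by (simp only: diff_Suc_eq_diff_pred)
  ultimately have "y ^ Suc d dvd coeff h k - c * (y * coeff h (Suc k)) + c * (y * coeff h (Suc k))"
    by (intro dvd_add)
  with Suc.hyps(2) show ?case by simp
qed

lemma coeff_dvd_linear_factors:
  fixes y :: "'a::comm_ring_1"
  assumes "finite S" "\<And>k. y ^ (N - k) dvd coeff ((\<Prod>c\<in>S. [:- (c * y), 1:]) * h) k"
  shows "y ^ (N - card S - k) dvd coeff h k"
  using assms
proof (induction S arbitrary: N k)
  case (insert c S)
  have "y ^ (N - 1 - k) dvd coeff ((\<Prod>c\<in>S. [:- (c * y), 1:]) * h) k" for k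
    by (rule coeff_dvd_linear_factor[of y N c])
      (use insert.prems[unfolded prod.insert[OF insert.hyps] mult.assoc] in blast)
  then have "y ^ (N - 1 - card S - k) dvd coeff h k" by (rule insert.IH)
  with insert.hyps show ?case by simp
qed simp

lemma coeff_dvd_linear_factors_power:
  fixes y :: "'a::comm_ring_1"
  assumes "finite S" "\<And>k. y ^ (N - k) dvd coeff ((\<Prod>c\<in>S. [:- (c * y), 1:]) ^ j * h) k"
  shows "y ^ (N - card S * j - k) dvd coeff h k"
  using assms(2)
proof (induction j arbitrary: N k)
  case (Suc j)
  have "y ^ (N - card S - k) dvd coeff ((\<Prod>c\<in>S. [:- (c * y), 1:]) ^ j * h) k" for k
    by (rule coeff_dvd_linear_factors[OF assms(1)]) (use Suc.prems[unfolded power_Suc mult.assoc] in blast)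
  then have "y ^ (N - card S - card S * j - k) dvd coeff h k" by (rule Suc.IH)
  then show ?case by simp
qed simp

text \<open>
  Polynomials over an arbitrary integral domain need not factor uniquely, so the coprimality of
  distinct monic linear factors is taken from the orders at their roots.
\<close>

lemma prod_linear_power_dvd:
  fixes p :: "'a::idom poly"
  assumes "finite S" "\<And>a. a \<in> S \<Longrightarrow> [:- a, 1:] ^ N dvd p"
  shows "(\<Prod>a\<in>S. [:- a, 1:]) ^ N dvd p"
  using assms
proof (induction S)
  case (insert a S)
  let ?P = "(\<Prod>a\<in>S. [:- a, 1:]) ^ N"
  obtain q where q: "p = ?P * q" using insert by (auto simp: dvd_def)
  show ?case
  proof (cases "p = 0")
    case False
    have "poly ?P a \<noteq> 0" using insert.hyps by (auto simp: poly_prod)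
    then have "order a ?P = 0" by (rule order_0I)
    moreover have "N \<le> order a p" using insert.prems[of a] False by (simp add: order_divides)
    ultimately have "N \<le> order a q" using False by (simp add: q order_mult)
    then have "[:- a, 1:] ^ N dvd q" by (simp add: order_divides)
    then have "?P * [:- a, 1:] ^ N dvd ?P * q" by (rule mult_dvd_mono[OF dvd_refl])
    then show ?thesis by (simp only: q prod.insert[OF insert.hyps] power_mult_distrib mult.commute)
  qed simp
qed simp

text \<open>
  If \<open>f\<close> lies in \<open>(Z, l)\<^sup>N\<close> for finitely many distinct monic linear \<open>l\<close>, then its coefficients
  satisfy the criterion for membership in \<open>(Z, \<Prod> l)\<^sup>N\<close>.
\<close>

lemma coeff_dvd_Inter:
  fixes f :: "'a::idom poly poly"
  assumes "finite S" "\<And>a. a \<in> S \<Longrightarrow> f \<in> ideal_power (rmod.span {[:0, 1:], [:[:- a, 1:]:]}) N"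
  shows "(\<Prod>a\<in>S. [:- a, 1:]) ^ (N - k) dvd coeff f k"
  using assms by (intro prod_linear_power_dvd coeff_dvd_if_mem_power) auto

lemma subspace_coeffs: "rmod.subspace J \<Longrightarrow> rmod.subspace {f. \<forall>i. coeff f i \<in> J}"
  by (rule rmod.subspaceI)
    (simp_all add: rmod.subspace_0 rmod.subspace_add coeff_mult rmod.subspace_sum ideal_scale)

lemma coeff_mem_ideal_power:
  assumes "f \<in> ideal_power (rmod.span ((\<lambda>b. [:b:]) ` B)) N"
  shows "coeff f i \<in> ideal_power (rmod.span B) N"
proof -
  let ?I = "rmod.span ((\<lambda>b. [:b:]) ` B)" and ?J = "rmod.span B"
  have I: "?I \<subseteq> {f. \<forall>i. coeff f i \<in> ?J}"
    by (rule rmod.span_minimal[OF _ subspace_coeffs[OF rmod.subspace_span]])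
      (auto simp: coeff_pCons rmod.span_zero intro: rmod.span_base split: nat.splits)
  have "ideal_power ?I N \<subseteq> {f. \<forall>i. coeff f i \<in> ideal_power ?J N}"
  proof (induction N)
    case (Suc N)
    show ?case unfolding ideal_power.simps
    proof (rule ideal_mult_least[OF subspace_coeffs[OF subspace_ideal_mult]])
      fix a b assume "a \<in> ?I" "b \<in> ideal_power ?I N"
      then have "\<forall>i. coeff a i \<in> ?J" "\<forall>i. coeff b i \<in> ideal_power ?J N" using I Suc by auto
      then show "a * b \<in> {f. \<forall>i. coeff f i \<in> ideal_mult ?J (ideal_power ?J N)}"
        by (simp add: coeff_mult rmod.subspace_sum subspace_ideal_mult mem_ideal_mult)
    qed
  qed simp
  with assms show ?thesis by blast
qed

text \<open>
  Here \<open>X\<close> is the innermost and \<open>Z\<close> the outermost variable. The coefficient of \<open>Z\<^sup>i\<close> in \<open>f\<close> is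
  divisible by \<open>F\<close> to the power \<open>N - i\<close>, and the cofactor keeps at least the order
  \<open>N' - card S * (N - i)\<close>. Where \<open>i > N\<close> the truncated difference is the intended exponent \<open>0\<close>.
\<close>

lemma almost_collinear_span_poly:
  fixes f :: "'k::field poly poly poly" and S :: "'k set"
  defines "X \<equiv> [:[:[:0, 1:]:]:]" and "Y \<equiv> [:[:0, 1:]:]" and "Z \<equiv> [:0, 1:]"
  defines "F \<equiv> (\<Prod>c\<in>S. [:[:[:0, - c:], 1:]:])"
  assumes S: "finite S" and f: "\<And>c. c \<in> S \<Longrightarrow> f \<in> ideal_power (rmod.span {Z, [:[:[:0, - c:], 1:]:]}) N"
    and f': "f \<in> ideal_power (rmod.span {X, Y}) N'"
  shows "f \<in> rmod.span {Z ^ i * F ^ j * G | i j k G.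
    G \<in> ideal_power (rmod.span {X, Y}) k \<and> N \<le> i + j \<and> N' \<le> k + card S * j}" (is "f \<in> rmod.span ?T")
proof -
  let ?x = "[:0, 1:] :: 'k poly"
  define F0 where "F0 = (\<Prod>c\<in>S. [:- ([:c:] * ?x), 1:])"
  let ?F1 = "\<Prod>a\<in>(\<lambda>c. [:c:] * ?x) ` S. [:- a, 1:]"
  have inj: "inj_on (\<lambda>c. [:c:] * ?x) S" by (auto intro: inj_onI)
  have F1: "?F1 = F0" unfolding F0_def prod.reindex[OF inj] by simp
  have F0': "F0 = (\<Prod>b\<in>(\<lambda>c. [:c:]) ` S. [:- (b * ?x), 1:])"
    by (simp add: F0_def prod.reindex inj_on_def)
  have F: "F = [:F0:]" unfolding F_def F0_def hom_prod[OF is_ring_hom_pCons] by (rule prod.cong) simp_all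
  have "Z ^ i * [:coeff f i:] \<in> rmod.span ?T" for i
  proof -
    have "?F1 ^ (N - i) dvd coeff f i"
      by (rule coeff_dvd_Inter) (use S f in \<open>auto simp: Z_def\<close>)
    then obtain h where h: "coeff f i = F0 ^ (N - i) * h" unfolding F1 by (auto simp: dvd_def)
    have XY: "{X, Y} = (\<lambda>b. [:b:]) ` {[:0, 1:], [:?x:]}" by (auto simp: X_def Y_def)
    have "coeff f i \<in> ideal_power (rmod.span {[:0, 1:], [:?x:]}) N'"
      by (rule coeff_mem_ideal_power) (use f' in \<open>simp only: XY\<close>)
    then have "?x ^ (N' - k) dvd coeff (F0 ^ (N - i) * h) k" for k
      unfolding h[symmetric] by (rule coeff_dvd_if_mem_power)
    then have "?x ^ (N' - card S * (N - i) - k) dvd coeff h k" for k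
      using coeff_dvd_linear_factors_power[of "(\<lambda>c. [:c:]) ` S" ?x N' "N - i" h k] S
      by (simp add: F0' card_image inj_on_def)
    then have "h \<in> ideal_power (rmod.span {[:0, 1:], [:?x:]}) (N' - card S * (N - i))"
      by (rule mem_power_if_coeff_dvd)
    then have "[:h:] \<in> ideal_power (rmod.span {X, Y}) (N' - card S * (N - i))"
      unfolding XY by (rule hom_ideal_power_span[OF is_ring_hom_pCons])
    then have "Z ^ i * F ^ (N - i) * [:h:] \<in> ?T"
      by (intro CollectI exI[of _ i] exI[of _ "N - i"] exI[of _ "N' - card S * (N - i)"] exI[of _ "[:h:]"]) auto
    then have "Z ^ i * F ^ (N - i) * [:h:] \<in> rmod.span ?T" by (rule rmod.span_base)
    moreover have "F ^ (N - i) * [:h:] = [:coeff f i:]"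
      unfolding h F by (simp only: hom_mult[OF is_ring_hom_pCons] hom_power[OF is_ring_hom_pCons])
    ultimately show ?thesis by (simp only: mult.assoc)
  qed
  then have "(\<Sum>i\<le>degree f. [:coeff f i:] * Z ^ i) \<in> rmod.span ?T"
    by (intro rmod.span_sum) (simp only: mult.commute)
  then show ?thesis unfolding Z_def by (simp only: poly_sum_monom)
qed

section \<open>Division by a monic polynomial\<close>

text \<open>
  Long division by a monic polynomial, keeping all coefficients in an ideal of the coefficient
  ring.
\<close>

lemma monic_division:
  fixes g F :: "'a::comm_ring_1 poly"
  assumes J: "rmod.subspace J" and F: "coeff F n = 1" "degree F = n" "n > 0"
    and g: "\<And>k. coeff g k \<in> J"
  obtains q r where "g = F * q + r" "\<And>k. n \<le> k \<Longrightarrow> coeff r k = 0" "degree q \<le> degree g - n"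
    "\<And>k. coeff q k \<in> J" "\<And>k. coeff r k \<in> J"
  using g
proof (induction "degree g" arbitrary: g thesis rule: less_induct)
  case less
  show ?case
  proof (cases "degree g < n")
    case True
    show ?thesis by (rule less.prems(1)[of 0 g])
        (use True less.prems(2) rmod.subspace_0[OF J] in \<open>auto simp: coeff_eq_0\<close>)
  next
    case False
    let ?m = "monom (lead_coeff g) (degree g - n)"
    let ?g = "g - F * ?m"
    have Fm: "coeff (F * ?m) k = (if k < degree g - n then 0 else lead_coeff g * coeff F (k - (degree g - n)))" for k
      by (subst mult.commute) (simp add: coeff_monom_mult)
    have top: "coeff ?g k = 0" if "degree g \<le> k" for k
    proof (cases "k = degree g")
      case True
      with False F show ?thesis by (simp add: Fm)
    next
      case k: False
      with that False have "n < k - (degree g - n)" by linarith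
      with k that F show ?thesis by (simp add: Fm coeff_eq_0)
    qed
    have "degree g > 0" using False F(3) by linarith
    then have deg: "degree ?g < degree g"
      using top by (intro degree_lessI disjI2 allI impI)
    have "coeff ?g k \<in> J" for k
      using less.prems(2) by (auto simp: Fm intro!: rmod.subspace_diff[OF J] ideal_scale'[OF J] rmod.subspace_0[OF J])
    then obtain q r where qr: "?g = F * q + r" "\<And>k. n \<le> k \<Longrightarrow> coeff r k = 0" "degree q \<le> degree ?g - n"
      "\<And>k. coeff q k \<in> J" "\<And>k. coeff r k \<in> J"
      using less.hyps[OF deg] by blast
    show ?thesis
    proof (rule less.prems(1)[of "q + ?m" r])
      show "g = F * (q + ?m) + r" using qr(1) by (simp add: algebra_simps)
      show "degree (q + ?m) \<le> degree g - n"
        using qr(3) deg by (intro degree_add_le degree_monom_le) linarith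
      show "coeff (q + ?m) k \<in> J" for k
        using qr(4) less.prems(2) rmod.subspace_0[OF J] by (auto intro: rmod.subspace_add[OF J])
    qed (use qr in auto)
  qed
qed

lemma monic_division_unique:
  fixes F :: "'a::idom poly"
  assumes F: "coeff F n = 1" "degree F = n"
    and r: "\<And>k. n \<le> k \<Longrightarrow> coeff r k = 0" "\<And>k. n \<le> k \<Longrightarrow> coeff r' k = 0"
    and eq: "F * q + r = F * q' + r'"
  shows "q = q'" "r = r'"
proof -
  show "q = q'"
  proof (rule ccontr)
    assume "q \<noteq> q'"
    moreover have "F \<noteq> 0" using F by auto
    ultimately have "degree (F * (q - q')) = n + degree (q - q')" "F * (q - q') \<noteq> 0"
      by (simp_all add: degree_mult_eq F)
    moreover have "F * (q - q') = r' - r" using eq by (simp add: algebra_simps)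
    moreover have "coeff (r' - r) (n + degree (q - q')) = 0" using r by simp
    ultimately show False by (metis leading_coeff_0_iff)
  qed
  with eq show "r = r'" by simp
qed

text \<open>
  Dividing an element of \<open>(x, F)\<^sup>N\<close> by \<open>F\<close>, the remainder is divisible by \<open>x\<^sup>N\<close> and the
  quotient lies in \<open>(x, F)\<close> to the power \<open>N - 1\<close>.
\<close>

lemma monic_division_power:
  fixes F :: "'a::idom poly"
  assumes F: "coeff F n = 1" "degree F = n" "n > 0"
    and r: "\<And>k. n \<le> k \<Longrightarrow> coeff r k = 0"
    and mem: "F * q + r \<in> ideal_power (rmod.span {[:x:], F}) N"
  shows "x ^ N dvd coeff r k" "q \<in> ideal_power (rmod.span {[:x:], F}) (N - 1)"
proof -
  let ?I = "rmod.span {[:x:], F}"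
  obtain g h where gh: "g \<in> ideal_power ?I (N - 1)" "F * q + r = F * g + [:x:] ^ N * h"
    by (rule span2_power_split[OF mem])
  obtain h1 h0 where h: "h = F * h1 + h0" "\<And>k. n \<le> k \<Longrightarrow> coeff h0 k = 0"
    using monic_division[of UNIV F n h] F rmod.subspace_UNIV by blast
  have pow: "[:x:] ^ N = [:x ^ N:]" by (simp add: hom_power[OF is_ring_hom_pCons])
  have eq: "F * q + r = F * (g + [:x:] ^ N * h1) + [:x:] ^ N * h0"
    unfolding gh(2) h(1) by (simp only: algebra_simps)
  have z: "coeff ([:x:] ^ N * h0) k = 0" if "n \<le> k" for k
    using h(2)[OF that] by (simp add: pow)
  from monic_division_unique[OF F(1,2) r z eq]
  have q: "q = g + [:x:] ^ N * h1" and r: "r = [:x:] ^ N * h0" by simp_all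
  show "x ^ N dvd coeff r k" by (simp add: r pow)
  have "[:x:] ^ N \<in> ideal_power ?I N"
    by (rule power_mem_ideal_power) (simp add: rmod.span_base)
  then have "[:x:] ^ N \<in> ideal_power ?I (N - 1)"
    using ideal_power_antimono[of "N - 1" N ?I] by auto
  then show "q \<in> ideal_power ?I (N - 1)"
    unfolding q by (intro rmod.subspace_add[OF subspace_ideal_power] gh ideal_scale'[OF subspace_ideal_power])
qed

lemma monomial_span_poly2:
  fixes s :: "'a::idom poly poly"
  defines "x \<equiv> [:[:0, 1:]:]" and "y \<equiv> [:0, 1:]"
  assumes "x ^ N dvd s" "y ^ N dvd s" "s \<in> ideal_power (rmod.span {x, y}) N'"
  shows "s \<in> rmod.span {x ^ a * y ^ b | a b. N \<le> a \<and> N \<le> b \<and> N' \<le> a + b}" (is "_ \<in> rmod.span ?T")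
proof -
  let ?x = "[:0, 1:] :: 'a poly"
  have "[:coeff s b:] * [:0, 1:] ^ b \<in> rmod.span ?T" for b
  proof (cases "b < N")
    case True
    have "monom 1 N dvd s" using assms(4) by (simp add: y_def monom_altdef)
    with True show ?thesis by (simp add: monom_1_dvd_iff' rmod.span_zero)
  next
    case False
    have "x ^ N = [:?x ^ N:]" by (simp add: x_def hom_power[OF is_ring_hom_pCons])
    then have "?x ^ N dvd coeff s b" using assms(3) by (simp add: const_poly_dvd_iff)
    moreover have "?x ^ (N' - b) dvd coeff s b"
      by (rule coeff_dvd_if_mem_power) (use assms(5) in \<open>simp add: x_def y_def insert_commute\<close>)
    ultimately obtain t where t: "coeff s b = ?x ^ (max N (N' - b)) * t"
      by (cases "N \<le> N' - b") (auto simp: max_def dvd_def)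
    have "x ^ (max N (N' - b)) * y ^ b \<in> ?T"
      by (intro CollectI exI[of _ "max N (N' - b)"] exI[of _ b]) (use False in auto)
    then have "[:t:] * (x ^ (max N (N' - b)) * y ^ b) \<in> rmod.span ?T"
      by (intro rmod.span_scale rmod.span_base)
    moreover have "[:coeff s b:] = [:t:] * x ^ (max N (N' - b))"
      unfolding t x_def hom_mult[OF is_ring_hom_pCons] hom_power[OF is_ring_hom_pCons] by (rule mult.commute)
    ultimately show ?thesis by (simp only: y_def mult.assoc)
  qed
  then have "(\<Sum>b\<le>degree s. [:coeff s b:] * [:0, 1:] ^ b) \<in> rmod.span ?T"
    by (intro rmod.span_sum)
  then show ?thesis by (simp only: poly_sum_monom)
qed

text \<open>
  Division by the monic \<open>F\<close> splits off a remainder whose coefficients lie in the intersection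
  of \<open>(X\<^sup>N)\<close>, \<open>(Y\<^sup>N)\<close> and the \<open>N'\<close>-th power of \<open>(X, Y)\<close>, an ideal spanned by monomials. The
  quotient satisfies the hypotheses for \<open>N - 1\<close> and the same \<open>N'\<close>, and it is zero or of smaller
  degree.
\<close>

lemma nearly_complete_span_poly:
  fixes g F :: "'a::idom poly poly poly"
  defines "X \<equiv> [:[:[:0, 1:]:]:]" and "Y \<equiv> [:[:0, 1:]:]"
  assumes F: "coeff F n = 1" "degree F = n" "n > 0"
    and "g \<in> ideal_power (rmod.span {X, F}) N" "g \<in> ideal_power (rmod.span {Y, F}) N"
      "g \<in> ideal_power (rmod.span {X, Y}) N'"
  shows "g \<in> rmod.span {X ^ a * Y ^ b * F ^ c | a b c. N \<le> a + c \<and> N \<le> b + c \<and> N' \<le> a + b}"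
  using assms(6-8)
proof (induction "degree g" arbitrary: g N rule: less_induct)
  case less
  let ?x = "[:[:0, 1:]:] :: 'a poly poly" and ?y = "[:0, 1:] :: 'a poly poly"
  let ?T = "\<lambda>N. {X ^ a * Y ^ b * F ^ c | a b c. N \<le> a + c \<and> N \<le> b + c \<and> N' \<le> a + b}"
  let ?J = "ideal_power (rmod.span {?x, ?y}) N'"
  have XY: "{X, Y} = (\<lambda>b. [:b:]) ` {?x, ?y}" by (auto simp: X_def Y_def)
  have coeffs: "coeff g k \<in> ?J" for k
    by (rule coeff_mem_ideal_power) (use less.prems(3) in \<open>simp only: XY\<close>)
  obtain q r where qr: "g = F * q + r" "\<And>k. n \<le> k \<Longrightarrow> coeff r k = 0" "degree q \<le> degree g - n"
    "\<And>k. coeff q k \<in> ?J" "\<And>k. coeff r k \<in> ?J"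
    using monic_division[OF subspace_ideal_power F coeffs] by blast
  have X: "?x ^ N dvd coeff r k" "q \<in> ideal_power (rmod.span {X, F}) (N - 1)" for k
    using monic_division_power[of F n r q ?x N] F qr(1,2) less.prems(1) by (auto simp: X_def)
  have Y: "?y ^ N dvd coeff r k" "q \<in> ideal_power (rmod.span {Y, F}) (N - 1)" for k
    using monic_division_power[of F n r q ?y N] F qr(1,2) less.prems(2) by (auto simp: Y_def)
  have hT: "(\<lambda>s. [:s:]) ` {?x ^ a * ?y ^ b | a b. N \<le> a \<and> N \<le> b \<and> N' \<le> a + b} \<subseteq> rmod.span (?T N)"
  proof safe
    fix a b assume "N \<le> a" "N \<le> b" "N' \<le> a + b"
    then have "X ^ a * Y ^ b * F ^ 0 \<in> ?T N"
      by (intro CollectI exI[of _ a] exI[of _ b] exI[of _ 0]) simp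
    then have "X ^ a * Y ^ b \<in> rmod.span (?T N)" using rmod.span_base[of "X ^ a * Y ^ b * F ^ 0" "?T N"] by simp
    then show "[:?x ^ a * ?y ^ b:] \<in> rmod.span (?T N)"
      by (simp only: X_def Y_def hom_mult[OF is_ring_hom_pCons] hom_power[OF is_ring_hom_pCons])
  qed
  have "[:coeff r k:] \<in> rmod.span (?T N)" for k
    using monomial_span_poly2[OF X(1) Y(1) qr(5)] hT
    by (rule hom_span[OF is_ring_hom_pCons]) (rule rmod.subspace_span)
  then have "(\<Sum>k\<le>degree r. [:coeff r k:] * [:0, 1:] ^ k) \<in> rmod.span (?T N)"
    by (intro rmod.span_sum ideal_scale'[OF rmod.subspace_span])
  then have r: "r \<in> rmod.span (?T N)" by (simp only: poly_sum_monom)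
  have "F * q \<in> rmod.span (?T N)"
  proof (cases "degree g < n")
    case True
    have "F * 0 + g = F * q + r" using qr(1) by simp
    moreover have "coeff g k = 0" if "n \<le> k" for k using True that by (simp add: coeff_eq_0)
    ultimately have "0 = q" using monic_division_unique(1)[OF F(1,2) _ qr(2)] by blast
    then show ?thesis by (simp add: rmod.span_zero)
  next
    case False
    with F(3) qr(3) have deg: "degree q < degree g" by linarith
    have qJ: "q \<in> ideal_power (rmod.span {X, Y}) N'"
    proof -
      have "[:coeff q k:] \<in> ideal_power (rmod.span {X, Y}) N'" for k
        unfolding XY using qr(4) by (rule hom_ideal_power_span[OF is_ring_hom_pCons])
      then have "(\<Sum>k\<le>degree q. [:coeff q k:] * [:0, 1:] ^ k) \<in> ideal_power (rmod.span {X, Y}) N'"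
        by (intro rmod.subspace_sum[OF subspace_ideal_power] ideal_scale'[OF subspace_ideal_power])
      then show ?thesis by (simp only: poly_sum_monom)
    qed
    have "?T (N - 1) \<subseteq> {a. a * F \<in> rmod.span (?T N)}"
    proof safe
      fix a b c assume "N - 1 \<le> a + c" "N - 1 \<le> b + c" "N' \<le> a + b"
      then have "X ^ a * Y ^ b * F ^ Suc c \<in> ?T N"
        by (intro CollectI exI[of _ a] exI[of _ b] exI[of _ "Suc c"]) auto
      then have "X ^ a * Y ^ b * F ^ Suc c \<in> rmod.span (?T N)" by (rule rmod.span_base)
      then show "X ^ a * Y ^ b * F ^ c * F \<in> rmod.span (?T N)" by (simp only: power_Suc2 mult.assoc)
    qed
    then have "rmod.span (?T (N - 1)) \<subseteq> {a. a * F \<in> rmod.span (?T N)}"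
      by (rule rmod.span_minimal) (rule subspace_colon[OF rmod.subspace_span])
    with less.hyps[OF deg X(2) Y(2) qJ] show ?thesis by (auto simp: mult.commute)
  qed
  with r show ?case unfolding qr(1) by (intro rmod.span_add)
qed

section \<open>Splitting monomials into equal factors\<close>

text \<open>
  Both quotients are rounded down, which loses less than \<open>2\<close> from their sum. As \<open>(a + b) / t\<close> is
  at least \<open>m + 1 - 1 / t\<close>, at least \<open>m\<close> remains.
\<close>

lemma div_sum_bounds:
  fixes t m N e :: nat
  assumes N: "t * (m + 1) \<le> N + e" "e \<le> 1" and t: "t > 0" and ab: "N \<le> a + b"
  shows "m \<le> a div t + b div t" "a div t + b div t = m \<Longrightarrow> t - e \<le> a mod t + b mod t"
proof -
  have eq: "a + b = t * (a div t + b div t) + (a mod t + b mod t)"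
    by (simp add: algebra_simps)
  have lt: "a mod t < t" "b mod t < t" using t by simp_all
  show "m \<le> a div t + b div t"
  proof (rule ccontr)
    assume "\<not> ?thesis"
    then have "t * (a div t + b div t + 1) \<le> t * m" by (intro mult_le_mono2) simp
    then have "t * (a div t + b div t) + t \<le> t * m" by simp
    moreover have "t * m + t \<le> N + e" using N(1) by simp
    ultimately show False using eq lt N(2) ab by linarith
  qed
  assume "a div t + b div t = m"
  with eq have "a + b = t * m + (a mod t + b mod t)" by simp
  moreover have "t * m + t \<le> N + e" using N(1) by simp
  ultimately show "t - e \<le> a mod t + b mod t" using ab by linarith
qed

lemma split_exponents_3:
  fixes t m N e :: nat
  assumes N: "t * (m + 1) \<le> N + e" "e \<le> 1" and t: "t > 0"
    and abc: "N \<le> a + c" "N \<le> b + c" "N \<le> a + b"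
  obtains \<alpha> \<beta> \<gamma> q r s where "a = t * \<alpha> + q" "b = t * \<beta> + r" "c = t * \<gamma> + s"
    "m \<le> \<alpha> + \<gamma>" "m \<le> \<beta> + \<gamma>" "m \<le> \<alpha> + \<beta>" "t - e \<le> q + r + s"
proof -
  note bounds = div_sum_bounds[OF N t abc(1)] div_sum_bounds[OF N t abc(2)] div_sum_bounds[OF N t abc(3)]
  have dm: "a = t * (a div t) + a mod t" "b = t * (b div t) + b mod t" "c = t * (c div t) + c mod t"
    by simp_all
  have lower: "a = t * (a div t - 1) + (a mod t + t)" if pos: "a div t > 0" for a :: nat
  proof -
    obtain k where "a div t = Suc k" using gr0_implies_Suc[OF pos] by blast
    then show ?thesis using mult_div_mod_eq[of t a] by (simp add: algebra_simps)
  qed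
  show ?thesis
  proof (cases "a div t + c div t = m \<or> b div t + c div t = m \<or> a div t + b div t = m")
    case True
    then have "t - e \<le> a mod t + b mod t + c mod t" using bounds by linarith
    with bounds show ?thesis by (intro that[OF dm]) auto
  next
    case False
    then have gt: "m < a div t + c div t" "m < b div t + c div t" "m < a div t + b div t"
      using bounds by linarith+
    show ?thesis
    proof (cases "a div t > 0")
      case True
      with gt show ?thesis by (intro that[OF lower[OF True] dm(2,3)]) auto
    next
      case False
      with gt have "b div t > 0" by linarith
      with gt show ?thesis by (intro that[OF dm(1) lower dm(3)]) auto
    qed
  qed
qed

text \<open>
  The exponents of a product \<open>u\<^sup>i F\<^sup>j G\<close>, where \<open>G\<close> has order \<open>k\<close> and \<open>F\<close> has order \<open>n\<close>. A
  rounding loss in \<open>j\<close> would count \<open>n\<close>-fold in \<open>k + n j\<close>; to avoid it, a power \<open>F\<^sup>\<rho>\<close> is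
  absorbed into \<open>G\<close>.
\<close>

lemma split_exponents_form:
  fixes t m N e n :: nat
  assumes N: "t * (m + 1) \<le> N + e" "e \<le> 1" and t: "t > 0" and n: "n > 0"
    and ijk: "N \<le> i + j" "N \<le> k + n * j"
  obtains \<alpha> \<gamma> \<delta> q r \<rho> s where "i = t * \<alpha> + q" "j = t * \<gamma> + r + \<rho>" "k + n * \<rho> = t * \<delta> + s"
    "m \<le> \<alpha> + \<gamma>" "m \<le> \<delta> + n * \<gamma>" "t - e \<le> q + r + s"
proof -
  \<comment> \<open>First split with all of the remainder of \<open>j\<close> absorbed, then lower one quotient where there is slack.\<close>
  define \<alpha> q \<gamma> \<rho> where "\<alpha> = i div t" "q = i mod t" "\<gamma> = j div t" "\<rho> = j mod t"
  define \<delta> s where "\<delta> = (k + n * \<rho>) div t" "s = (k + n * \<rho>) mod t"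
  have i: "i = t * \<alpha> + q" and j: "j = t * \<gamma> + 0 + \<rho>" and k: "k + n * \<rho> = t * \<delta> + s"
    by (simp_all add: \<alpha>_q_\<gamma>_\<rho>_def \<delta>_s_def)
  note b1 = div_sum_bounds[OF N t ijk(1), folded \<alpha>_q_\<gamma>_\<rho>_def]
  have eq: "k + n * j = t * (\<delta> + n * \<gamma>) + s"
    using k by (simp add: j algebra_simps)
  have "(k + n * j) div t = \<delta> + n * \<gamma>" "(k + n * j) mod t = s"
    unfolding eq using t by (simp_all add: \<delta>_s_def)
  then have b2: "m \<le> \<delta> + n * \<gamma>" "\<delta> + n * \<gamma> = m \<Longrightarrow> t - e \<le> s"
    using div_sum_bounds[OF N t, of "k + n * j" 0] ijk(2) by simp_all
  show ?thesis
  proof (cases "\<delta> + n * \<gamma> = m")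
    case True
    with b1 b2 show ?thesis by (intro that[OF i j k]) auto
  next
    case False
    with b2 have gt: "m < \<delta> + n * \<gamma>" by linarith
    show ?thesis
    proof (cases \<delta>)
      case (Suc d)
      then have "k + n * \<rho> = t * d + (s + t)" using k by simp
      with gt b1 Suc show ?thesis by (intro that[OF i j]) auto
    next
      case 0
      have "\<rho> \<le> n * \<rho>" using n by simp
      moreover have "k + n * \<rho> = s" using 0 k by simp
      ultimately have s: "\<rho> \<le> s" by linarith
      show ?thesis
      proof (cases "\<alpha> + \<gamma> = m")
        case True
        with b1(2) s have "t - e \<le> q + 0 + s" by linarith
        with True b2 show ?thesis by (intro that[OF i j k]) auto
      next
        case False
        with b1 have gt': "m < \<alpha> + \<gamma>" by linarith
        show ?thesis
        proof (cases \<alpha>)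
          case (Suc d)
          then have "i = t * d + (q + t)" using i by simp
          with gt' b2 Suc show ?thesis by (intro that[OF _ j k]) auto
        next
          case 0
          with gt' obtain d where d: "\<gamma> = Suc d" "m \<le> d" by (cases \<gamma>) auto
          then have "j = t * d + t + \<rho>" using j by simp
          moreover have "1 * d \<le> n * d" using n by (intro mult_le_mono1) simp
          then have "m \<le> n * d" using d(2) by linarith
          ultimately show ?thesis using d 0 i k by (intro that[of \<alpha> q d t \<rho> \<delta> s]) auto
        qed
      qed
    qed
  qed
qed

text \<open>
  The factors of \<open>u\<^sup>i F\<^sup>j G\<close> left over by the splitting lie in \<open>M\<close>; the rest is a product of
  \<open>t\<close> elements of \<open>S\<close>, or a sum of such products, since \<open>G\<close> need not be a monomial.
\<close>

lemma form_mem_product_power: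
  fixes u F G :: "'r::comm_ring_1"
  assumes N: "t * (m + 1) \<le> N + e" "e \<le> 1" and t: "t > 0" and n: "n > 0"
    and M: "u \<in> M" "F \<in> M" "V \<subseteq> M"
    and S: "\<And>\<alpha> \<gamma> \<delta> H. m \<le> \<alpha> + \<gamma> \<Longrightarrow> m \<le> \<delta> + n * \<gamma> \<Longrightarrow> H \<in> ideal_power V \<delta> \<Longrightarrow> u ^ \<alpha> * F ^ \<gamma> * H \<in> S"
    and F: "F \<in> ideal_power V n" and G: "G \<in> ideal_power V k"
    and ijk: "N \<le> i + j" "N \<le> k + n * j"
  shows "u ^ i * F ^ j * G \<in> ideal_mult (ideal_power M (t - e)) (ideal_power S t)" (is "_ \<in> ?T")
proof -
  obtain \<alpha> \<gamma> \<delta> q r \<rho> s where split: "i = t * \<alpha> + q" "j = t * \<gamma> + r + \<rho>" "k + n * \<rho> = t * \<delta> + s"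
    "m \<le> \<alpha> + \<gamma>" "m \<le> \<delta> + n * \<gamma>" "t - e \<le> q + r + s"
    by (rule split_exponents_form[OF N t n ijk])
  have "F ^ \<rho> \<in> ideal_power V (n * \<rho>)"
    by (induction \<rho>) (auto intro: mult_mem_ideal_power[OF F])
  then have "F ^ \<rho> * G \<in> ideal_power V (t * \<delta> + s)"
    using G by (rule mult_mem_ideal_power) (use split in simp)
  moreover have "ideal_mult (ideal_power V (t * \<delta>)) (ideal_power V s)
      \<subseteq> {H. H * (u ^ (t * \<alpha> + q) * F ^ (t * \<gamma> + r)) \<in> ?T}"
  proof (rule ideal_mult_least[OF subspace_colon[OF subspace_ideal_mult]])
    fix A B assume A: "A \<in> ideal_power V (t * \<delta>)" and B: "B \<in> ideal_power V s"
    have "u ^ q * F ^ r \<in> ideal_power M (q + r)" "B \<in> ideal_power M s"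
      using B ideal_power_mono[OF M(3)] by (auto intro: power_mult_mem_ideal_power M)
    then have 1: "u ^ q * F ^ r * B \<in> ideal_power M (t - e)"
      by (rule mult_mem_ideal_power) (use split in simp)
    have "A \<in> ideal_power (ideal_power V \<delta>) t" using A ideal_power_mult_subset by blast
    then have 2: "(u ^ \<alpha> * F ^ \<gamma>) ^ t * A \<in> ideal_power S t"
      using S[OF split(4,5)] by (rule ideal_power_translate[rotated])
    have "(u ^ q * F ^ r * B) * ((u ^ \<alpha> * F ^ \<gamma>) ^ t * A) = A * B * (u ^ (t * \<alpha> + q) * F ^ (t * \<gamma> + r))"
      by (simp add: power_add power_mult_distrib mult_ac flip: power_mult)
    with mem_ideal_mult[OF 1 2]
    show "A * B \<in> {H. H * (u ^ (t * \<alpha> + q) * F ^ (t * \<gamma> + r)) \<in> ?T}" by simp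
  qed
  ultimately have "F ^ \<rho> * G * (u ^ (t * \<alpha> + q) * F ^ (t * \<gamma> + r)) \<in> ?T"
    by (auto simp: ideal_power_add)
  then show ?thesis by (simp add: split(1,2) power_add mult_ac)
qed

lemma monomial_mem_product_power:
  fixes u v F :: "'r::comm_ring_1"
  assumes N: "t * (m + 1) \<le> N + e" "e \<le> 1" and t: "t > 0"
    and M: "u \<in> M" "v \<in> M" "F \<in> M"
    and S: "\<And>\<alpha> \<beta> \<gamma>. m \<le> \<alpha> + \<gamma> \<Longrightarrow> m \<le> \<beta> + \<gamma> \<Longrightarrow> m \<le> \<alpha> + \<beta> \<Longrightarrow> u ^ \<alpha> * v ^ \<beta> * F ^ \<gamma> \<in> S"
    and abc: "N \<le> a + c" "N \<le> b + c" "N \<le> a + b"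
  shows "u ^ a * v ^ b * F ^ c \<in> ideal_mult (ideal_power M (t - e)) (ideal_power S t)"
proof -
  obtain \<alpha> \<beta> \<gamma> q r s where split: "a = t * \<alpha> + q" "b = t * \<beta> + r" "c = t * \<gamma> + s"
    "m \<le> \<alpha> + \<gamma>" "m \<le> \<beta> + \<gamma>" "m \<le> \<alpha> + \<beta>" "t - e \<le> q + r + s"
    by (rule split_exponents_3[OF N t abc])
  have "u ^ q * v ^ r \<in> ideal_power M (q + r)" by (intro power_mult_mem_ideal_power M order_refl)
  then have 1: "u ^ q * v ^ r * F ^ s \<in> ideal_power M (t - e)"
    using power_mem_ideal_power[OF M(3)] split(7) by (rule mult_mem_ideal_power)
  have 2: "(u ^ \<alpha> * v ^ \<beta> * F ^ \<gamma>) ^ t \<in> ideal_power S t"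
    using S[OF split(4-6)] by (rule power_mem_ideal_power)
  have "(u ^ q * v ^ r * F ^ s) * (u ^ \<alpha> * v ^ \<beta> * F ^ \<gamma>) ^ t = u ^ a * v ^ b * F ^ c"
    unfolding split(1-3) by (simp add: power_add power_mult_distrib mult_ac flip: power_mult)
  with mem_ideal_mult[OF 1 2] show ?thesis by simp
qed

section \<open>Symbolic powers in coordinates\<close>

lemma symbolic_powerD: "f \<in> symbolic_power Z N \<Longrightarrow> q \<in> Z \<Longrightarrow> f \<in> ideal_power (point_ideal q) N"
  by (auto simp: symbolic_power_def)

lemma mem_max_ideal_if_linear:
  assumes "homogeneous 1 l"
  shows "l \<in> max_ideal"
proof -
  obtain c where c: "l = (\<Sum>i\<in>UNIV. const (c i) * var i)" using homogeneous_1_expand[OF assms] .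
  have "var i \<in> max_ideal" for i
  proof -
    have "(3 :: 3) = 0" by simp
    then have "i = 1 \<or> i = 2 \<or> i = 0" using exhaust_3[of i] by metis
    then show ?thesis by (auto simp: max_ideal_def intro: rmod.span_base)
  qed
  then show ?thesis
    unfolding c max_ideal_def by (intro rmod.span_sum rmod.span_scale) auto
qed

lemma point_ideal_line:
  assumes "coord_sys a b c u v w"
  shows "point_ideal (point (b + s *s c)) = rmod.span {u, w - const s * v}"
  by (rule point_ideal_eq[OF coord_sys_shear[OF assms]])

lemma hom_span_image:
  assumes "f \<in> rmod.span A" "h ` A \<subseteq> B" "is_ring_hom h"
  shows "h f \<in> rmod.span B"
  using assms rmod.span_superset[of B] by (intro hom_span[of h f A]) (auto simp: rmod.subspace_span)

lemma symbolic_power_almost_collinear: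
  fixes u :: "'k::field poly3"
  assumes cs: "coord_sys a b c u v w" and S: "finite S"
    and Z: "Z = insert (point a) ((\<lambda>s. point (b + s *s c)) ` S)"
  defines "F \<equiv> \<Prod>s\<in>S. w - const s * v"
  shows "symbolic_power Z N \<subseteq> rmod.span {u ^ i * F ^ j * G | i j k G.
    G \<in> ideal_power (rmod.span {v, w}) k \<and> N \<le> i + j \<and> N \<le> k + card S * j}"
proof
  fix f assume f: "f \<in> symbolic_power Z N"
  have cs': "coord_sys b c a v w u" using cs by (rule coord_sys_rotate)
  obtain \<Phi> :: "'k poly3 \<Rightarrow> 'k poly poly poly" and \<Psi>
    where \<Phi>: "is_ring_hom \<Phi>" and \<Psi>: "is_ring_hom \<Psi>" and inv: "\<And>f. \<Psi> (\<Phi> f) = f"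
    and vars: "\<Phi> v = [:[:[:0, 1:]:]:]" "\<Phi> w = [:[:0, 1:]:]" "\<Phi> u = [:0, 1:]" "\<And>k. \<Phi> (const k) = [:[:[:k:]:]:]"
    by (rule coord_sys_iso[OF cs']) (rule that)
  have lin: "\<Phi> (w - const s * v) = [:[:[:0, - s:], 1:]:]" for s
    by (simp add: hom_diff[OF \<Phi>] hom_mult[OF \<Phi>] vars)
  have \<Phi>F: "\<Phi> F = (\<Prod>s\<in>S. [:[:[:0, - s:], 1:]:])"
    unfolding F_def hom_prod[OF \<Phi>] lin by simp
  have 1: "\<Phi> f \<in> ideal_power (rmod.span {\<Phi> u, [:[:[:0, - s:], 1:]:]}) N" if "s \<in> S" for s
  proof -
    have "f \<in> ideal_power (rmod.span {u, w - const s * v}) N"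
      using symbolic_powerD[OF f, of "point (b + s *s c)"] that Z point_ideal_line[OF cs] by auto
    from hom_ideal_power_span[OF \<Phi> this] show ?thesis by (simp add: lin)
  qed
  have "f \<in> ideal_power (rmod.span {v, w}) N"
    using symbolic_powerD[OF f, of "point a"] Z point_ideal_eq[OF cs'] by auto
  from hom_ideal_power_span[OF \<Phi> this] have 2: "\<Phi> f \<in> ideal_power (rmod.span {\<Phi> v, \<Phi> w}) N" by simp
  have "\<Phi> f \<in> rmod.span {\<Phi> u ^ i * \<Phi> F ^ j * G | i j k G.
      G \<in> ideal_power (rmod.span {\<Phi> v, \<Phi> w}) k \<and> N \<le> i + j \<and> N \<le> k + card S * j}"
    unfolding \<Phi>F using almost_collinear_span_poly[OF S, of "\<Phi> f" N N] 1 2 unfolding vars by blast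
  then have "\<Psi> (\<Phi> f) \<in> rmod.span {u ^ i * F ^ j * G | i j k G.
    G \<in> ideal_power (rmod.span {v, w}) k \<and> N \<le> i + j \<and> N \<le> k + card S * j}"
  proof (rule hom_span_image[OF _ _ \<Psi>], safe)
    fix i j k G assume "G \<in> ideal_power (rmod.span {\<Phi> v, \<Phi> w}) k" "N \<le> i + j" "N \<le> k + card S * j"
    moreover from hom_ideal_power_span[OF \<Psi> this(1)] have "\<Psi> G \<in> ideal_power (rmod.span {v, w}) k"
      by (simp add: inv)
    moreover have "\<Psi> (\<Phi> u ^ i * \<Phi> F ^ j * G) = u ^ i * F ^ j * \<Psi> G"
      by (simp only: hom_mult[OF \<Psi>] hom_power[OF \<Psi>] inv)
    ultimately show "\<exists>i' j' k' G'. \<Psi> (\<Phi> u ^ i * \<Phi> F ^ j * G) = u ^ i' * F ^ j' * G' \<and>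
       G' \<in> ideal_power (rmod.span {v, w}) k' \<and> N \<le> i' + j' \<and> N \<le> k' + card S * j'" by blast
  qed
  then show "f \<in> rmod.span {u ^ i * F ^ j * G | i j k G.
    G \<in> ideal_power (rmod.span {v, w}) k \<and> N \<le> i + j \<and> N \<le> k + card S * j}" by (simp only: inv)
qed

text \<open>
  A polynomial lying in the \<open>N\<close>-th power of the ideal of every point \<open>b + s c\<close> of the line
  \<open>u = 0\<close> lies in the \<open>N\<close>-th power of the ideal generated by \<open>u\<close> and the product of the
  \<open>w - s v\<close>.
\<close>

lemma power_Inter_line:
  fixes u :: "'k::field poly3"
  assumes cs: "coord_sys a b c u v w" and S: "finite S"
    and f: "\<And>s. s \<in> S \<Longrightarrow> f \<in> ideal_power (rmod.span {u, w - const s * v}) N"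
  shows "f \<in> ideal_power (rmod.span {u, \<Prod>s\<in>S. w - const s * v}) N"
proof -
  obtain \<Phi> :: "'k poly3 \<Rightarrow> 'k poly poly poly" and \<Psi>
    where \<Phi>: "is_ring_hom \<Phi>" and \<Psi>: "is_ring_hom \<Psi>" and inv: "\<And>f. \<Psi> (\<Phi> f) = f"
    and vars: "\<Phi> v = [:[:[:0, 1:]:]:]" "\<Phi> w = [:[:0, 1:]:]" "\<Phi> u = [:0, 1:]" "\<And>k. \<Phi> (const k) = [:[:[:k:]:]:]"
    by (rule coord_sys_iso[OF coord_sys_rotate[OF cs]]) (rule that)
  let ?S = "(\<lambda>s. [:0, s:]) ` S"
  have lin: "\<Phi> (w - const s * v) = [:[:- [:0, s:], 1:]:]" for s
    by (simp add: hom_diff[OF \<Phi>] hom_mult[OF \<Phi>] vars)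
  have F: "\<Phi> (\<Prod>s\<in>S. w - const s * v) = [:\<Prod>a\<in>?S. [:- a, 1:]:]"
    unfolding hom_prod[OF \<Phi>] hom_prod[OF is_ring_hom_pCons] lin by (subst prod.reindex) (auto simp: inj_on_def)
  have "\<Phi> f \<in> ideal_power (rmod.span {[:0, 1:], [:[:- a, 1:]:]}) N" if "a \<in> ?S" for a
    using that hom_ideal_power_span[OF \<Phi> f] by (auto simp: lin vars)
  then have "(\<Prod>a\<in>?S. [:- a, 1:]) ^ (N - k) dvd coeff (\<Phi> f) k" for k
    using S by (intro coeff_dvd_Inter) auto
  then have "\<Phi> f \<in> ideal_power (rmod.span {\<Phi> u, \<Phi> (\<Prod>s\<in>S. w - const s * v)}) N"
    unfolding F vars by (rule mem_power_if_coeff_dvd)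
  from hom_ideal_power_span[OF \<Psi> this] show ?thesis by (simp add: inv)
qed

lemma prod_congruent_power:
  fixes u w :: "'r::comm_ring_1"
  assumes "finite T"
  obtains h where "(\<Prod>t\<in>T. w - c t * u) = w ^ card T + u * h"
  using assms
proof (induction T arbitrary: thesis)
  case empty
  from empty[of 0] show ?case by simp
next
  case (insert t T)
  from insert.IH obtain h where "(\<Prod>t\<in>T. w - c t * u) = w ^ card T + u * h" by blast
  with insert.hyps have "(\<Prod>t\<in>insert t T. w - c t * u) = w ^ card (insert t T) + u * (w * h - c t * w ^ card T - c t * u * h)"
    by (simp add: algebra_simps)
  then show ?case by (rule insert.prems)
qed

text \<open>
  For \<open>card S = card T\<close>, a form which restricts to \<open>\<Prod> (w - s v)\<close> on the line \<open>u = 0\<close> and to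
  \<open>\<Prod> (w - t u)\<close> on the line \<open>v = 0\<close>.
\<close>

definition glued_form :: "'k::field poly3 \<Rightarrow> 'k poly3 \<Rightarrow> 'k poly3 \<Rightarrow> 'k set \<Rightarrow> 'k set \<Rightarrow> 'k poly3" where
  "glued_form u v w S T = (\<Prod>s\<in>S. w - const s * v) + (\<Prod>t\<in>T. w - const t * u) - w ^ card S"

lemma glued_form_swap: "card S = card T \<Longrightarrow> glued_form v u w T S = glued_form u v w S T"
  by (simp add: glued_form_def add.commute)

lemma glued_form_restrict:
  assumes "finite T" "card S = card T"
  obtains h where "glued_form u v w S T = (\<Prod>s\<in>S. w - const s * v) + u * h"
proof -
  obtain h where "(\<Prod>t\<in>T. w - const t * u) = w ^ card T + u * h"
    by (rule prod_congruent_power[OF assms(1), of w const u])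
  then have "glued_form u v w S T = (\<Prod>s\<in>S. w - const s * v) + u * h"
    using assms(2) by (simp add: glued_form_def)
  then show ?thesis by (rule that)
qed

lemma span_glued_form:
  assumes "finite T" "card S = card T"
  shows "(\<Prod>s\<in>S. w - const s * v) \<in> rmod.span {u, glued_form u v w S T}"
proof -
  obtain h where "glued_form u v w S T = (\<Prod>s\<in>S. w - const s * v) + u * h"
    by (rule glued_form_restrict[OF assms])
  then have "(\<Prod>s\<in>S. w - const s * v) = u * (- h) + glued_form u v w S T * 1" by simp
  then show ?thesis using span2_combination[of u "- h" "glued_form u v w S T" 1] by simp
qed

lemma mem_power_glued_form:
  fixes u :: "'k::field poly3"
  assumes cs: "coord_sys a b c u v w" and S: "finite S" and T: "finite T" "card S = card T"
    and f: "\<And>s. s \<in> S \<Longrightarrow> f \<in> ideal_power (point_ideal (point (b + s *s c))) N"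
  shows "f \<in> ideal_power (rmod.span {u, glued_form u v w S T}) N"
proof -
  have "rmod.span {u, \<Prod>s\<in>S. w - const s * v} \<subseteq> rmod.span {u, glued_form u v w S T}"
    by (rule rmod.span_minimal) (simp_all add: rmod.subspace_span rmod.span_base span_glued_form[OF T])
  moreover have "f \<in> ideal_power (rmod.span {u, \<Prod>s\<in>S. w - const s * v}) N"
    by (rule power_Inter_line[OF cs S]) (use f in \<open>simp add: point_ideal_line[OF cs]\<close>)
  ultimately show ?thesis using ideal_power_mono by blast
qed

lemma prod_linear_monic:
  fixes c :: "'b \<Rightarrow> 'a::idom"
  shows "degree (\<Prod>i\<in>A. [:- c i, 1:]) = card A" "coeff (\<Prod>i\<in>A. [:- c i, 1:]) (card A) = 1"
proof -
  show deg: "degree (\<Prod>i\<in>A. [:- c i, 1:]) = card A"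
    by (subst degree_prod_eq_sum_degree) simp_all
  have "lead_coeff (\<Prod>i\<in>A. [:- c i, 1:]) = 1" by (simp add: lead_coeff_prod)
  then show "coeff (\<Prod>i\<in>A. [:- c i, 1:]) (card A) = 1" unfolding deg .
qed

lemma symbolic_power_nearly_complete:
  fixes u :: "'k::field poly3"
  assumes cs: "coord_sys a b c u v w" and S: "finite S" and T: "finite T" and card: "card S = card T" "card S > 0"
    and Z: "Z = insert (point c) ((\<lambda>s. point (b + s *s c)) ` S \<union> (\<lambda>t. point (a + t *s c)) ` T)"
  defines "F \<equiv> glued_form u v w S T"
  shows "symbolic_power Z N \<subseteq> rmod.span {u ^ i * v ^ j * F ^ k | i j k. N \<le> i + k \<and> N \<le> j + k \<and> N \<le> i + j}"
proof
  fix f assume f: "f \<in> symbolic_power Z N"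
  have f1: "f \<in> ideal_power (rmod.span {u, F}) N" unfolding F_def
    by (rule mem_power_glued_form[OF cs S T card(1)]) (use f Z in \<open>simp add: symbolic_powerD\<close>)
  have f2: "f \<in> ideal_power (rmod.span {v, F}) N"
    using mem_power_glued_form[OF coord_sys_swap[OF cs] T S card(1)[symmetric], of f N] f Z
    by (simp add: symbolic_powerD F_def glued_form_swap[OF card(1)])
  have f3: "f \<in> ideal_power (rmod.span {u, v}) N"
    using symbolic_powerD[OF f, of "point c"] Z point_ideal_eq[OF cs] by auto
  obtain \<Phi> :: "'k poly3 \<Rightarrow> 'k poly poly poly" and \<Psi>
    where \<Phi>: "is_ring_hom \<Phi>" and \<Psi>: "is_ring_hom \<Psi>" and inv: "\<And>f. \<Psi> (\<Phi> f) = f"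
    and vars: "\<Phi> u = [:[:[:0, 1:]:]:]" "\<Phi> v = [:[:0, 1:]:]" "\<Phi> w = [:0, 1:]" "\<And>k. \<Phi> (const k) = [:[:[:k:]:]:]"
    by (rule coord_sys_iso[OF cs]) (rule that)
  let ?n = "card S"
  have lin: "\<Phi> (w - const s * v) = [:- [:0, [:s:]:], 1:]" "\<Phi> (w - const s * u) = [:- [:[:0, s:]:], 1:]" for s
    by (simp_all add: hom_diff[OF \<Phi>] hom_mult[OF \<Phi>] vars)
  let ?P = "\<Prod>s\<in>S. [:- [:0, [:s:]:], 1:] :: 'k poly poly poly" and ?Q = "\<Prod>t\<in>T. [:- [:[:0, t:]:], 1:]"
  have PQ: "\<Phi> (\<Prod>s\<in>S. w - const s * v) = ?P" "\<Phi> (\<Prod>t\<in>T. w - const t * u) = ?Q"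
    unfolding hom_prod[OF \<Phi>] lin by simp_all
  have \<Phi>F: "\<Phi> F = ?P + ?Q - monom 1 ?n"
    unfolding F_def glued_form_def
    by (simp only: hom_diff[OF \<Phi>] hom_add[OF \<Phi>] hom_power[OF \<Phi>] PQ vars(3))
      (simp add: monom_altdef)
  have F1: "coeff (\<Phi> F) ?n = 1"
    using prod_linear_monic(2)[of "\<lambda>s. [:0, [:s:]:]" S] prod_linear_monic(2)[of "\<lambda>t. [:[:0, t:]:]" T]
    by (simp add: \<Phi>F card(1))
  have "degree (\<Phi> F) \<le> ?n"
    unfolding \<Phi>F
    by (intro degree_diff_le degree_add_le degree_monom_le) (simp_all add: prod_linear_monic(1) card(1) del: minus_pCons)
  moreover have "?n \<le> degree (\<Phi> F)" by (rule le_degree) (simp add: F1)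
  ultimately have F2: "degree (\<Phi> F) = ?n" by simp
  have "\<Phi> f \<in> ideal_power (rmod.span {\<Phi> u, \<Phi> F}) N" "\<Phi> f \<in> ideal_power (rmod.span {\<Phi> v, \<Phi> F}) N"
    "\<Phi> f \<in> ideal_power (rmod.span {\<Phi> u, \<Phi> v}) N"
    using hom_ideal_power_span[OF \<Phi> f1] hom_ideal_power_span[OF \<Phi> f2] hom_ideal_power_span[OF \<Phi> f3] by simp_all
  then have "\<Phi> f \<in> rmod.span {\<Phi> u ^ i * \<Phi> v ^ j * \<Phi> F ^ k | i j k. N \<le> i + k \<and> N \<le> j + k \<and> N \<le> i + j}"
    using nearly_complete_span_poly[OF F1 F2 card(2), of "\<Phi> f" N N] unfolding vars by blast
  then have "\<Psi> (\<Phi> f) \<in> rmod.span {u ^ i * v ^ j * F ^ k | i j k. N \<le> i + k \<and> N \<le> j + k \<and> N \<le> i + j}"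
  proof (rule hom_span_image[OF _ _ \<Psi>], safe)
    fix i j k assume "N \<le> i + k" "N \<le> j + k" "N \<le> i + j"
    moreover have "\<Psi> (\<Phi> u ^ i * \<Phi> v ^ j * \<Phi> F ^ k) = u ^ i * v ^ j * F ^ k"
      by (simp only: hom_mult[OF \<Psi>] hom_power[OF \<Psi>] inv)
    ultimately show "\<exists>i' j' k'. \<Psi> (\<Phi> u ^ i * \<Phi> v ^ j * \<Phi> F ^ k) = u ^ i' * v ^ j' * F ^ k' \<and>
       N \<le> i' + k' \<and> N \<le> j' + k' \<and> N \<le> i' + j'" by blast
  qed
  then show "f \<in> rmod.span {u ^ i * v ^ j * F ^ k | i j k. N \<le> i + k \<and> N \<le> j + k \<and> N \<le> i + j}"
    by (simp only: inv)
qed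

section \<open>The containments in coordinates\<close>

lemma subspace_max_ideal: "rmod.subspace max_ideal"
  unfolding max_ideal_def by (rule rmod.subspace_span)

lemma prod_mem_ideal:
  assumes "rmod.subspace I" "finite A" "a \<in> A" "f a \<in> I"
  shows "(\<Prod>a\<in>A. f a) \<in> I"
  using assms by (simp add: prod.remove[of A a] ideal_scale')

lemma span_pair_subset: "rmod.subspace I \<Longrightarrow> x \<in> I \<Longrightarrow> y \<in> I \<Longrightarrow> rmod.span {x, y} \<subseteq> I"
  by (rule rmod.span_minimal) auto

lemma prod_mem_ideal_power:
  assumes "finite A" "\<And>a. a \<in> A \<Longrightarrow> f a \<in> I"
  shows "(\<Prod>a\<in>A. f a) \<in> ideal_power I (card A)"
  using assms by (induction A) (auto intro: mem_ideal_mult)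

lemma ideal_power_pow: "x \<in> ideal_power I n \<Longrightarrow> x ^ k \<in> ideal_power I (n * k)"
  by (induction k) (auto intro: mult_mem_ideal_power)

lemma pair_monomial_mem_power: "m \<le> i + j \<Longrightarrow> x ^ i * y ^ j \<in> ideal_power (rmod.span {x, y}) m"
  by (rule power_mult_mem_ideal_power) (auto intro: rmod.span_base)

lemma containment_almost_collinear:
  fixes u :: "'k::field poly3"
  assumes cs: "coord_sys a b c u v w" and S: "finite S" "S \<noteq> {}"
    and Z: "Z = insert (point a) ((\<lambda>s. point (b + s *s c)) ` S)"
    and N: "t * (m + 1) \<le> N + e" "e \<le> 1" and t: "t > 0"
  shows "symbolic_power Z N \<subseteq> ideal_mult (ideal_power max_ideal (t - e)) (ideal_power (symbolic_power Z m) t)"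
proof -
  define F where "F = (\<Prod>s\<in>S. w - const s * v)"
  let ?V = "rmod.span {v, w}"
  have hom: "homogeneous 1 u" "homogeneous 1 v" "homogeneous 1 w" using cs by (auto simp: coord_sys_def)
  have n: "card S > 0" using S by (simp add: card_gt_0_iff)
  have lV: "w - const s * v \<in> ?V" for s
    using span2_combination[of v "- const s" w 1] by (simp add: mult.commute)
  have VM: "?V \<subseteq> max_ideal"
    by (intro span_pair_subset subspace_max_ideal mem_max_ideal_if_linear hom)
  have FV: "F \<in> ideal_power ?V (card S)" unfolding F_def by (rule prod_mem_ideal_power[OF S(1) lV])
  obtain s0 where "s0 \<in> S" using S(2) by blast
  then have FM: "F \<in> max_ideal" unfolding F_def
    by (rule prod_mem_ideal[OF subspace_max_ideal S(1)]) (use lV VM in blast)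
  have sym: "u ^ i * F ^ j * H \<in> symbolic_power Z m"
    if "m \<le> i + j" "m \<le> k + card S * j" "H \<in> ideal_power ?V k" for i j k H
  proof -
    have "F ^ j * H \<in> ideal_power ?V m"
      using ideal_power_pow[OF FV] that(3) by (rule mult_mem_ideal_power) (use that(2) in simp)
    then have "u ^ i * (F ^ j * H) \<in> ideal_power (point_ideal (point a)) m"
      unfolding point_ideal_eq[OF coord_sys_rotate[OF cs]] by (rule ideal_scale[OF subspace_ideal_power])
    moreover have "u ^ i * F ^ j * H \<in> ideal_power (point_ideal (point (b + s *s c))) m" if "s \<in> S" for s
    proof -
      let ?I = "rmod.span {u, w - const s * v}"
      have "F \<in> ?I" unfolding F_def
        by (rule prod_mem_ideal[OF rmod.subspace_span S(1) that]) (simp add: rmod.span_base)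
      then have "u ^ i * F ^ j \<in> ideal_power ?I m"
        using \<open>m \<le> i + j\<close> by (intro power_mult_mem_ideal_power) (simp_all add: rmod.span_base)
      then show ?thesis unfolding point_ideal_line[OF cs] by (rule ideal_scale'[OF subspace_ideal_power])
    qed
    ultimately show ?thesis unfolding symbolic_power_def Z by (auto simp: mult.assoc)
  qed
  show ?thesis
  proof (rule order_trans[OF symbolic_power_almost_collinear[OF cs S(1) Z, of N, folded F_def]],
      rule rmod.span_minimal[OF _ subspace_ideal_mult], safe)
    fix i j k G assume G: "G \<in> ideal_power ?V k" and ijk: "N \<le> i + j" "N \<le> k + card S * j"
    show "u ^ i * F ^ j * G \<in> ideal_mult (ideal_power max_ideal (t - e)) (ideal_power (symbolic_power Z m) t)"
      by (rule form_mem_product_power[OF N t n mem_max_ideal_if_linear[OF hom(1)] FM VM _ FV G ijk]) (rule sym)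
  qed
qed

lemma containment_nearly_complete:
  fixes u :: "'k::field poly3"
  assumes cs: "coord_sys a b c u v w" and S: "finite S" and T: "finite T" and card: "card S = card T" "card S > 0"
    and Z: "Z = insert (point c) ((\<lambda>s. point (b + s *s c)) ` S \<union> (\<lambda>t. point (a + t *s c)) ` T)"
    and N: "t * (m + 1) \<le> N + e" "e \<le> 1" and t: "t > 0"
  shows "symbolic_power Z N \<subseteq> ideal_mult (ideal_power max_ideal (t - e)) (ideal_power (symbolic_power Z m) t)"
proof -
  define F where "F = glued_form u v w S T"
  have hom: "homogeneous 1 u" "homogeneous 1 v" "homogeneous 1 w" using cs by (auto simp: coord_sys_def)
  have cs': "coord_sys b a c v u w" using cs by (rule coord_sys_swap)
  have F_mem: "glued_form u v w S T \<in> rmod.span {u, w - const s * v}"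
    if ST: "finite S" "finite T" "card S = card T" "s \<in> S" for u v w :: "'k poly3" and S T s
  proof -
    obtain h where h: "glued_form u v w S T = (\<Prod>s\<in>S. w - const s * v) + u * h"
      by (rule glued_form_restrict[OF ST(2,3)])
    have "(\<Prod>s\<in>S. w - const s * v) \<in> rmod.span {u, w - const s * v}"
      by (rule prod_mem_ideal[OF rmod.subspace_span ST(1,4)]) (simp add: rmod.span_base)
    moreover have "u * h \<in> rmod.span {u, w - const s * v}"
      by (rule ideal_scale'[OF rmod.subspace_span]) (simp add: rmod.span_base)
    ultimately show ?thesis unfolding h by (rule rmod.span_add)
  qed
  have FS: "F \<in> rmod.span {u, w - const s * v}" if "s \<in> S" for s
    unfolding F_def by (rule F_mem[OF S T card(1) that])
  have FT: "F \<in> rmod.span {v, w - const s * u}" if "s \<in> T" for s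
    unfolding F_def glued_form_swap[OF card(1), symmetric] by (rule F_mem[OF T S card(1)[symmetric] that])
  obtain s0 where s0: "s0 \<in> S" using card(2) by (metis card.empty ex_in_conv less_irrefl)
  have "w - const s0 * v \<in> max_ideal"
    by (intro mem_max_ideal_if_linear homogeneous_1_combination hom)
  then have FM: "F \<in> max_ideal"
    using FS[OF s0] span_pair_subset[OF subspace_max_ideal mem_max_ideal_if_linear[OF hom(1)]] by blast
  have sym: "u ^ i * v ^ j * F ^ k \<in> symbolic_power Z m"
    if "m \<le> i + k" "m \<le> j + k" "m \<le> i + j" for i j k
  proof -
    have "u ^ i * v ^ j * F ^ k \<in> ideal_power (point_ideal (point c)) m"
      unfolding point_ideal_eq[OF cs]
      by (intro ideal_scale'[OF subspace_ideal_power] pair_monomial_mem_power that)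
    moreover have "u ^ i * v ^ j * F ^ k \<in> ideal_power (point_ideal (point (b + s *s c))) m" if "s \<in> S" for s
    proof -
      have "u ^ i * F ^ k \<in> ideal_power (rmod.span {u, w - const s * v}) m"
        using FS[OF that] \<open>m \<le> i + k\<close> by (intro power_mult_mem_ideal_power) (simp_all add: rmod.span_base)
      then have "v ^ j * (u ^ i * F ^ k) \<in> ideal_power (point_ideal (point (b + s *s c))) m"
        unfolding point_ideal_line[OF cs] by (rule ideal_scale[OF subspace_ideal_power])
      then show ?thesis by (simp add: mult_ac)
    qed
    moreover have "u ^ i * v ^ j * F ^ k \<in> ideal_power (point_ideal (point (a + s *s c))) m" if "s \<in> T" for s
    proof -
      have "v ^ j * F ^ k \<in> ideal_power (rmod.span {v, w - const s * u}) m"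
        using FT[OF that] \<open>m \<le> j + k\<close> by (intro power_mult_mem_ideal_power) (simp_all add: rmod.span_base)
      then have "u ^ i * (v ^ j * F ^ k) \<in> ideal_power (point_ideal (point (a + s *s c))) m"
        unfolding point_ideal_line[OF cs'] by (rule ideal_scale[OF subspace_ideal_power])
      then show ?thesis by (simp add: mult_ac)
    qed
    ultimately show ?thesis unfolding symbolic_power_def Z by auto
  qed
  show ?thesis
  proof (rule order_trans[OF symbolic_power_nearly_complete[OF cs S T card Z, of N, folded F_def]],
      rule rmod.span_minimal[OF _ subspace_ideal_mult], safe)
    fix i j k assume ijk: "N \<le> i + k" "N \<le> j + k" "N \<le> i + j"
    show "u ^ i * v ^ j * F ^ k \<in> ideal_mult (ideal_power max_ideal (t - e)) (ideal_power (symbolic_power Z m) t)"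
      by (rule monomial_mem_product_power[OF N t mem_max_ideal_if_linear[OF hom(1)]
          mem_max_ideal_if_linear[OF hom(2)] FM _ ijk]) (rule sym)
  qed
qed

section \<open>Choice of coordinates\<close>

lemma point_on_line:
  assumes cs: "coord_sys a b c u v w" and p: "p \<noteq> 0" "eval_at u p = 0" "eval_at v p \<noteq> 0"
  shows "point p = point (b + (eval_at w p / eval_at v p) *s c)"
proof -
  let ?s = "eval_at w p / eval_at v p"
  have "p = eval_at v p *s b + eval_at w p *s c"
    using coord_sys_expand[OF cs, of p] p(2) by simp
  also have "\<dots> = eval_at v p *s (b + ?s *s c)"
    using p(3) by (simp add: vec_eq_iff field_simps)
  finally have eq: "p = eval_at v p *s (b + ?s *s c)" .
  moreover from eq p(1) have "b + ?s *s c \<noteq> 0" by auto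
  ultimately show ?thesis using point_eq_iff[of "b + ?s *s c" p] p by metis
qed

lemma points_representatives:
  fixes p :: "nat \<Rightarrow> 'k::field proj_plane"
  obtains q where "\<And>i. q i \<noteq> 0" "\<And>i. p i = point (q i)"
proof -
  have "\<forall>i. \<exists>v. v \<noteq> 0 \<and> p i = point v" by (metis point_exists)
  then show ?thesis using that by metis
qed

lemma almost_collinear_coordinates:
  fixes Z :: "'k::field_char_0 proj_plane set"
  assumes "almost_collinear Z"
  obtains a b c u v w S where "coord_sys a b c u v w" "finite S" "S \<noteq> {}"
    "Z = insert (point a) ((\<lambda>s. point (b + s *s c)) ` S)"
proof -
  obtain n :: nat and p L where n: "n \<ge> 2" and inj: "inj_on p {0..n}" and Zp: "Z = p ` {0..n}"
    and L: "is_line L" "p ` {1..n} \<subseteq> L" "p 0 \<notin> L"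
    using assms unfolding almost_collinear_def by blast
  obtain l where l: "homogeneous 1 l" "L = {p. vanishes_at l p}"
    using L(1) unfolding is_line_def by blast
  obtain q where q: "\<And>i. q i \<noteq> 0" "\<And>i. p i = point (q i)" using points_representatives[of p] by blast
  have l0: "eval_at l (q 0) \<noteq> 0" using L(3) l q by (simp add: vanishes_at_point_iff[of 1])
  have li: "eval_at l (q i) = 0" if "i \<in> {1..n}" for i
  proof -
    have "p i \<in> L" using L(2) that by blast
    then show ?thesis using l q by (simp add: vanishes_at_point_iff[of 1])
  qed
  have "p 1 \<noteq> p 2" using inj_onD[OF inj, of 1 2] n by auto
  have indep: "x = 0 \<and> y = 0" if xy: "x *s q 1 + y *s q 2 = 0" for x y
  proof -
    have x: "x *s q 1 = (- y) *s q 2" using xy by (simp add: eq_neg_iff_add_eq_0 vec_eq_iff)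
    have "x = 0"
    proof (rule ccontr)
      assume "x \<noteq> 0"
      then have "q 1 = inverse x *s (x *s q 1)" by (simp add: vector_smult_assoc)
      then have q1: "q 1 = (inverse x * (- y)) *s q 2" by (simp only: x vector_smult_assoc)
      with q(1)[of 1] have "inverse x * (- y) \<noteq> 0" by auto
      with q1 have "p 1 = p 2" using q(2)[of 1] q(2)[of 2] point_eq_iff[OF q(1)[of 2] q(1)[of 1]] by metis
      with \<open>p 1 \<noteq> p 2\<close> show False by blast
    qed
    with x q(1)[of 2] show ?thesis by (auto simp: vec_eq_iff)
  qed
  \<comment> \<open>The line is infinite, hence carries a point \<open>c\<close> outside \<open>Z\<close>, to be used as a coordinate point.\<close>
  let ?e = "\<lambda>s. q 2 + s *s q 1"
  have e_nz: "?e s \<noteq> 0" for s using indep[of s 1] by (auto simp: add.commute)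
  have "inj (\<lambda>s. point (?e s))"
  proof (rule injI)
    fix s s' assume "point (?e s) = point (?e s')"
    then obtain k where k: "?e s' = k *s ?e s" using point_eq_iff[OF e_nz e_nz] by blast
    then have "(s' - k * s) *s q 1 + (1 - k) *s q 2 = 0"
      by (simp add: vec_eq_iff algebra_simps)
    from indep[OF this] show "s = s'" by simp
  qed
  then have "infinite (range (\<lambda>s. point (?e s)))"
    using infinite_UNIV_char_0 finite_imageD by blast
  moreover have "finite Z" by (simp add: Zp)
  ultimately obtain s0 where s0: "point (?e s0) \<notin> Z" by (meson finite_subset image_subsetI)
  define c where "c = ?e s0"
  have lc: "eval_at l c = 0" unfolding c_def
    using li[of 1] li[of 2] n by (simp add: linear_add[OF l(1)] linear_scale[OF l(1)])
  obtain u v w where cs: "coord_sys (q 0) (q 1) c u v w"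
  proof (rule coord_sys_exists)
    fix x y z assume 0: "x *s q 0 + y *s q 1 + z *s c = 0"
    have "eval_at l (x *s q 0 + y *s q 1 + z *s c) = x * eval_at l (q 0)"
      using li[of 1] n by (simp add: linear_add[OF l(1)] linear_scale[OF l(1)] lc)
    then have x: "x = 0" using 0 l0 by (simp add: linear_0[OF l(1)])
    have "(y + z * s0) *s q 1 + z *s q 2 = 0"
      using 0 x by (simp add: c_def vec_eq_iff algebra_simps)
    from indep[OF this] x show "x = 0 \<and> y = 0 \<and> z = 0" by auto
  qed (rule that)
  \<comment> \<open>As \<open>c\<close> is not one of the points, each of them on the line is of the form \<open>b + s c\<close>.\<close>
  define \<sigma> where "\<sigma> i = eval_at w (q i) / eval_at v (q i)" for i
  have pi: "p i = point (q 1 + \<sigma> i *s c)" if i: "i \<in> {1..n}" for i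
  proof -
    have ex: "q i = eval_at u (q i) *s q 0 + eval_at v (q i) *s q 1 + eval_at w (q i) *s c"
      by (rule coord_sys_expand[OF cs])
    then have "eval_at l (q i) = eval_at l (eval_at u (q i) *s q 0 + eval_at v (q i) *s q 1 + eval_at w (q i) *s c)"
      by simp
    then have u: "eval_at u (q i) = 0"
      using li[OF i] li[of 1] n l0 by (simp add: linear_add[OF l(1)] linear_scale[OF l(1)] lc)
    have v: "eval_at v (q i) \<noteq> 0"
    proof
      assume "eval_at v (q i) = 0"
      with ex u have qi: "q i = eval_at w (q i) *s c" by simp
      then have "eval_at w (q i) \<noteq> 0" "c \<noteq> 0" using q(1)[of i] by auto
      with qi have "point c = p i" using q point_eq_iff[of c "q i"] by auto
      moreover have "p i \<in> Z" using i by (auto simp: Zp)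
      ultimately show False using s0 by (simp add: c_def)
    qed
    show ?thesis unfolding q(2)[of i] \<sigma>_def by (rule point_on_line[OF cs q(1) u v])
  qed
  show ?thesis
  proof (rule that[OF cs, of "\<sigma> ` {1..n}"])
    have "{0..n} = insert 0 {1..n}" by auto
    then have "Z = insert (p 0) (p ` {1..n})" by (simp add: Zp)
    also have "p ` {1..n} = (\<lambda>s. point (q 1 + s *s c)) ` \<sigma> ` {1..n}"
      unfolding image_image by (rule image_cong) (simp_all add: pi)
    finally show "Z = insert (point (q 0)) ((\<lambda>s. point (q 1 + s *s c)) ` \<sigma> ` {1..n})"
      by (simp add: q(2))
  qed (use n in auto)
qed

lemma nearly_complete_coordinates:
  fixes Z :: "'k::field proj_plane set"
  assumes "nearly_complete_intersection Z"
  obtains a b c u v w S T where "coord_sys a b c u v w" "finite S" "finite T" "card S = card T" "card S > 0"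
    "Z = insert (point c) ((\<lambda>s. point (b + s *s c)) ` S \<union> (\<lambda>t. point (a + t *s c)) ` T)"
proof -
  obtain n :: nat and p L1 L2 where n: "n \<ge> 1" and inj: "inj_on p {0..2 * n}" and Zp: "Z = p ` {0..2 * n}"
    and L0: "L1 \<inter> L2 = {p 0}" and L: "is_line L1" "is_line L2"
      "p ` {1..n} \<subseteq> L1 - L2" "p ` {n + 1..2 * n} \<subseteq> L2 - L1"
    using assms unfolding nearly_complete_intersection_def by (elim exE conjE) (rule that)
  obtain l1 where l1: "homogeneous 1 l1" "L1 = {p. vanishes_at l1 p}"
    using L(1) unfolding is_line_def by blast
  obtain l2 where l2: "homogeneous 1 l2" "L2 = {p. vanishes_at l2 p}"
    using L(2) unfolding is_line_def by blast
  obtain q where q: "\<And>i. q i \<noteq> 0" "\<And>i. p i = point (q i)" using points_representatives[of p] by blast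
  have mem: "p i \<in> L1 \<longleftrightarrow> eval_at l1 (q i) = 0" "p i \<in> L2 \<longleftrightarrow> eval_at l2 (q i) = 0" for i
    using l1 l2 q by (simp_all add: vanishes_at_point_iff[of 1])
  have z: "eval_at l1 (q 0) = 0" "eval_at l2 (q 0) = 0" using L0 mem by blast+
  have first: "eval_at l1 (q i) = 0" "eval_at l2 (q i) \<noteq> 0" if "i \<in> {1..n}" for i
    using L(3) mem that by blast+
  have second: "eval_at l2 (q i) = 0" "eval_at l1 (q i) \<noteq> 0" if "i \<in> {n + 1..2 * n}" for i
    using L(4) mem that by blast+
  \<comment> \<open>The coordinate points are the intersection of the lines and one further point on each.\<close>
  define a b c where "a = q (n + 1)" "b = q 1" "c = q 0"
  have l1abc: "eval_at l1 a \<noteq> 0" "eval_at l1 b = 0" "eval_at l1 c = 0"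
    and l2abc: "eval_at l2 a = 0" "eval_at l2 b \<noteq> 0" "eval_at l2 c = 0"
    using first[of 1] second[of "n + 1"] z n by (auto simp: a_b_c_def)
  have lin: "eval_at l1 (x *s a + y *s b + z *s c) = x * eval_at l1 a"
    "eval_at l2 (x *s a + y *s b + z *s c) = y * eval_at l2 b" for x y z
    by (simp_all add: linear_add[OF l1(1)] linear_scale[OF l1(1)] linear_add[OF l2(1)] linear_scale[OF l2(1)] l1abc l2abc)
  obtain u v w where cs: "coord_sys a b c u v w"
  proof (rule coord_sys_exists)
    fix x y z assume 0: "x *s a + y *s b + z *s c = 0"
    have "x = 0" "y = 0"
      using lin[of x y z] 0 l1abc(1) l2abc(2) by (simp_all add: linear_0[OF l1(1)] linear_0[OF l2(1)])
    moreover from this 0 have "z = 0" using q(1)[of 0] by (auto simp: a_b_c_def vec_eq_iff)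
    ultimately show "x = 0 \<and> y = 0 \<and> z = 0" by blast
  qed (rule that)
  have l1q: "eval_at l1 (q i) = eval_at u (q i) * eval_at l1 a"
    and l2q: "eval_at l2 (q i) = eval_at v (q i) * eval_at l2 b" for i
    using lin[of "eval_at u (q i)" "eval_at v (q i)" "eval_at w (q i)"] coord_sys_expand[OF cs, of "q i"] by simp_all
  define \<sigma> where "\<sigma> i = eval_at w (q i) / eval_at v (q i)" for i
  define \<tau> where "\<tau> i = eval_at w (q i) / eval_at u (q i)" for i
  have ps: "p i = point (b + \<sigma> i *s c)" if "i \<in> {1..n}" for i
    unfolding q(2)[of i] \<sigma>_def
    by (rule point_on_line[OF cs q(1)]) (use first[OF that] l1q l2q l1abc in auto)
  have pt: "p i = point (a + \<tau> i *s c)" if "i \<in> {n + 1..2 * n}" for i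
    unfolding q(2)[of i] \<tau>_def
    by (rule point_on_line[OF coord_sys_swap[OF cs] q(1)]) (use second[OF that] l1q l2q l2abc in auto)
  have "inj_on \<sigma> {1..n}"
  proof (rule inj_onI)
    fix i j assume "i \<in> {1..n}" "j \<in> {1..n}" "\<sigma> i = \<sigma> j"
    then show "i = j" using ps inj_onD[OF inj, of i j] by auto
  qed
  then have card_S: "card (\<sigma> ` {1..n}) = n" by (simp add: card_image)
  have "inj_on \<tau> {n + 1..2 * n}"
  proof (rule inj_onI)
    fix i j assume "i \<in> {n + 1..2 * n}" "j \<in> {n + 1..2 * n}" "\<tau> i = \<tau> j"
    then show "i = j" using pt inj_onD[OF inj, of i j] by auto
  qed
  then have card_T: "card (\<tau> ` {n + 1..2 * n}) = n" by (simp add: card_image)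
  show ?thesis
  proof (rule that[OF cs, of "\<sigma> ` {1..n}" "\<tau> ` {n + 1..2 * n}"])
    have "{0..2 * n} = insert 0 ({1..n} \<union> {n + 1..2 * n})" by auto
    then have "Z = insert (p 0) (p ` {1..n} \<union> p ` {n + 1..2 * n})" by (simp only: Zp image_insert image_Un)
    moreover have "p ` {1..n} = (\<lambda>s. point (b + s *s c)) ` \<sigma> ` {1..n}"
      unfolding image_image by (rule image_cong) (simp_all add: ps)
    moreover have "p ` {n + 1..2 * n} = (\<lambda>t. point (a + t *s c)) ` \<tau> ` {n + 1..2 * n}"
      unfolding image_image by (rule image_cong) (simp_all add: pt)
    ultimately show "Z = insert (point c) ((\<lambda>s. point (b + s *s c)) ` \<sigma> ` {1..n}
        \<union> (\<lambda>t. point (a + t *s c)) ` \<tau> ` {n + 1..2 * n})"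
      by (simp add: q(2) a_b_c_def)
  qed (use n card_S card_T in auto)
qed

theorem theorem3p12:
  fixes Z :: "'k::field_char_0 proj_plane set" and m t :: nat
  assumes "almost_collinear Z \<or> nearly_complete_intersection Z"
    and "m \<ge> 1" and "t \<ge> 1"
  shows "symbolic_power Z (t * (m + 1))
           \<subseteq> ideal_mult (ideal_power max_ideal t) (ideal_power (symbolic_power Z m) t)
       \<and> symbolic_power Z (t * (m + 1) - 1)
           \<subseteq> ideal_mult (ideal_power max_ideal (t - 1)) (ideal_power (symbolic_power Z m) t)"
proof -
  \<comment> \<open>The two containments are the cases \<open>e = 0\<close> and \<open>e = 1\<close>.\<close>
  have main: "symbolic_power Z N \<subseteq> ideal_mult (ideal_power max_ideal (t - e)) (ideal_power (symbolic_power Z m) t)"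
    if N: "t * (m + 1) \<le> N + e" "e \<le> 1" for N e
    using assms(1)
  proof
    assume "almost_collinear Z"
    then obtain a b c u v w S where "coord_sys a b c u v w" "finite S" "S \<noteq> {}"
      "Z = insert (point a) ((\<lambda>s. point (b + s *s c)) ` S)"
      by (rule almost_collinear_coordinates)
    then show ?thesis by (rule containment_almost_collinear) (use N assms(3) in auto)
  next
    assume "nearly_complete_intersection Z"
    then obtain a b c u v w S T where "coord_sys a b c u v w" "finite S" "finite T" "card S = card T" "card S > 0"
      "Z = insert (point c) ((\<lambda>s. point (b + s *s c)) ` S \<union> (\<lambda>t. point (a + t *s c)) ` T)"
      by (rule nearly_complete_coordinates)
    then show ?thesis by (rule containment_nearly_complete) (use N assms(3) in auto)
  qed
  show ?thesis using main[of "t * (m + 1)" 0] main[of "t * (m + 1) - 1" 1] by simp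
qed

end
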